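(* Let $p$ be a prime and let $a,h$ be positive integers. If a $\mathrm{BH}(\mathbb{Z}_{p^a},h)$ matrix exists, then $p$ divides $h$.
   Context: $\mathbb{Z}_n$ is the cyclic group of order $n$. A $\mathrm{BH}(\mathbb{Z}_n,h)$ matrix is an $n\times n$ matrix $H=(H_{g,k})_{g,k\in\mathbb{Z}_n}$ with entries complex $h$th roots of unity, $\mathbb{Z}_n$-invariant ($H_{g+l,k+l}=H_{g,k}$ for all $g,k,l$), with $HH^*=nI$, where $H^*$ is the conjugate transpose. *)

theory Defs
  imports Complex_Main "Jordan_Normal_Form.Schur_Decomposition"
begin

text \<open>
  The group \<open>Z_n\<close> is represented by its residues \<open>0, \<dots>, n - 1\<close> under addition modulo \<open>n\<close>,
  which are also the row and column indices of an \<open>n \<times> n\<close> matrix.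
\<close>

definition cyclic_invariant :: "nat \<Rightarrow> complex mat \<Rightarrow> bool" where
  "cyclic_invariant n H \<longleftrightarrow>
     (\<forall>g<n. \<forall>k<n. \<forall>l<n. H $$ ((g + l) mod n, (k + l) mod n) = H $$ (g, k))"

text \<open>On complex matrices \<^const>\<open>mat_adjoint\<close> is the conjugate transpose.\<close>

definition BH_cyclic :: "nat \<Rightarrow> nat \<Rightarrow> complex mat \<Rightarrow> bool" where
  "BH_cyclic n h H \<longleftrightarrow>
     H \<in> carrier_mat n n \<and>
     (\<forall>g<n. \<forall>k<n. (H $$ (g, k)) ^ h = 1) \<and>
     cyclic_invariant n H \<and>
     H * mat_adjoint H = of_nat n \<cdot>\<^sub>m 1\<^sub>m n"

end

theory Submission
  imports Defs "HOL-Number_Theory.Number_Theory"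
begin

text \<open>
  Let \<open>f\<close> be the first column of the matrix, \<open>n = p ^ a\<close> and \<open>y u = (\<Sum>g<n. f g * \<zeta> ^ (g * u))\<close> with
  \<open>\<zeta>\<close> a primitive \<open>n\<close>-th root of unity; then \<open>\<bar>y u\<bar>\<^sup>2 = n\<close> for all \<open>u\<close>. Suppose \<open>p\<close> does not
  divide \<open>h\<close>. Since \<open>p\<close> is totally ramified over the \<open>h\<close>-th cyclotomic field, \<open>y 1\<close> divides its
  conjugate \<open>y t\<close> for \<open>t\<close> coprime to \<open>p\<close>; all conjugates of the quotient have modulus 1, so by
  Kronecker \<open>y (t * u) = \<eta> * \<zeta> ^ (j * u) * y u\<close> with \<open>\<eta>\<close> a root of unity of order prime to \<open>p\<close>.

  If \<open>p\<close> is odd, a cyclic shift of \<open>f\<close> makes \<open>j = 0\<close> for \<open>t = 2\<close>, and commuting with \<open>t = 2\<close> gives \<open>j = 0\<close>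
  for all \<open>t\<close>. For \<open>t\<close> congruent to 1 modulo \<open>p\<close> then also \<open>\<eta> = 1\<close>, and averaging over these \<open>t\<close> leaves
  only the \<open>p\<close> terms with \<open>p ^ (a - 1)\<close> dividing \<open>g\<close>. If some \<open>\<eta>\<close> differs from 1, these values of
  \<open>f\<close> all coincide and \<open>y 1 = 0\<close>. Otherwise \<open>y 1\<close> is a difference of two values of \<open>f\<close>, so \<open>p ^ a \<le> 4\<close>
  and the quotient of the two values is a primitive cube root of unity.

  If \<open>p = 2\<close> and \<open>a \<ge> 3\<close>, then \<open>t = 1 + n / 2\<close> gives \<open>y (t * u) = \<plusminus> y u\<close> for odd \<open>u\<close>, so on odd frequencies
  only one parity class of indices contributes; by Parseval its transform vanishes on even frequencies,
  hence \<open>f (g + n / 2) = - f g\<close>, which is impossible for odd \<open>h\<close>. For \<open>n = 2, 4\<close> the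
  orthogonality of two rows already contains two opposite \<open>h\<close>-th roots of unity.
\<close>

section \<open>Evaluating integer polynomials at roots of unity\<close>

text \<open>An element of Z[w] is represented by an integer polynomial, so that the conjugation
  \<open>w\<close> to \<open>w ^ s\<close> becomes evaluation of the same polynomial at
  \<open>w ^ s\<close>.\<close>

definition int_eval :: "int poly \<Rightarrow> complex \<Rightarrow> complex" where
  "int_eval P z = poly (map_poly of_int P) z"

lemma int_eval_simps [simp]:
  "int_eval (P + Q) z = int_eval P z + int_eval Q z"
  "int_eval (P - Q) z = int_eval P z - int_eval Q z"
  "int_eval (P * Q) z = int_eval P z * int_eval Q z"
  "int_eval (- P) z = - int_eval P z"
  "int_eval (P ^ k) z = int_eval P z ^ k"
  "int_eval 0 z = 0" "int_eval 1 z = 1"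
  "int_eval (Polynomial.smult c P) z = of_int c * int_eval P z"
  "int_eval [:c:] z = of_int c"
  "int_eval (Polynomial.monom c k) z = of_int c * z ^ k"
  "int_eval (of_nat n) z = of_nat n"
  by (simp_all add: int_eval_def hom_distribs poly_monom map_poly_monom of_nat_poly)

lemma int_eval_pCons [simp]: "int_eval (pCons c P) z = of_int c + z * int_eval P z"
  by (simp add: int_eval_def hom_distribs)

lemma int_eval_sum [simp]: "int_eval (sum f A) z = (\<Sum>i\<in>A. int_eval (f i) z)"
  by (induction A rule: infinite_finite_induct) auto

lemma power_add_prime:
  fixes a b :: "'a::comm_ring_1"
  assumes "prime q"
  shows "\<exists>c. (a + b) ^ q = a ^ q + b ^ q + of_nat q * c"
proof -
  define t where "t k = of_nat (q choose k) * a ^ k * b ^ (q - k)" for k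
  have q: "q > 0" using assms prime_gt_0_nat by blast
  have "of_nat q dvd t k" if "k \<in> {0<..<q}" for k
  proof -
    have "q dvd q choose k"
      using that assms by (intro dvd_choose_prime) auto
    then show ?thesis
      by (auto simp: t_def elim!: dvdE)
  qed
  then have "of_nat q dvd sum t {0<..<q}" by (rule dvd_sum)
  moreover have "{..q} = insert 0 (insert q {0<..<q})" using q by auto
  then have "(a + b) ^ q = a ^ q + b ^ q + sum t {0<..<q}"
    using q unfolding binomial_ring t_def by (simp add: algebra_simps)
  ultimately show ?thesis by (auto elim: dvdE)
qed

lemma int_power_prime: 
  assumes "prime q" shows "\<exists>b::int. a ^ q = a + of_nat q * b"
proof -
  have "[a ^ q = a] (mod int q)"
  proof (cases "int q dvd a")
    case True
    moreover have "a dvd a ^ q" using assms prime_gt_0_nat by (simp add: dvd_power)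
    ultimately show ?thesis by (meson cong_iff_dvd_diff dvd_diff dvd_trans)
  next
    case False
    define b where "b = nat (a mod int q)"
    have q: "q > 0" using assms prime_gt_0_nat by blast
    have b: "[a = int b] (mod int q)" using q by (simp add: b_def cong_def)
    then have "\<not> q dvd b" using False using cong_dvd_iff[OF b] by (simp add: cong_dvd_iff)
    then have "[b ^ (q - 1) = 1] (mod q)" using fermat_theorem assms by blast
    then have "[b ^ (q - 1) * b = 1 * b] (mod q)" by (rule cong_scalar_right)
    then have "[b ^ q = b] (mod q)" using q by (simp add: power_eq_if mult.commute)
    then have "[int b ^ q = int b] (mod int q)" by (metis cong_int_iff of_nat_power)
    then show ?thesis using b by (meson cong_pow cong_sym cong_trans)
  qed
  then show ?thesis by (metis cong_iff_lin cong_sym of_int_of_nat_eq)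
qed

text \<open>Frobenius modulo \<open>q\<close>. The correction \<open>R\<close> is chosen before
  \<open>z\<close>, so that it stays an integer polynomial in whichever root of unity is
  inserted.\<close>

lemma int_eval_power_prime:
  assumes "prime q"
  shows "\<exists>R. \<forall>z. int_eval P z ^ q = int_eval P (z ^ q) + of_nat q * int_eval R z"
proof (induction P)
  case 0
  have "q > 0" using assms prime_gt_0_nat by blast
  then show ?case by (intro exI[of _ 0]) simp
next
  case (pCons a P)
  obtain R where R: "\<And>z. int_eval P z ^ q = int_eval P (z ^ q) + of_nat q * int_eval R z"
    using pCons by blast
  obtain b where b: "a ^ q = a + of_nat q * b" using int_power_prime[OF assms] by blast
  obtain C where C: "([:a:] + [:0,1:] * P) ^ q = [:a:] ^ q + ([:0,1:] * P) ^ q + of_nat q * C"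
    using power_add_prime[OF assms] by blast
  have "int_eval (pCons a P) z ^ q
      = int_eval (pCons a P) (z ^ q) + of_nat q * int_eval (C + [:b:] + Polynomial.monom 1 q * R) z" for z
  proof -
    have b': "complex_of_int a ^ q = of_int a + of_nat q * of_int b"
      using arg_cong[OF b, of complex_of_int] by simp
    have "int_eval (pCons a P) z ^ q = int_eval (([:a:] + [:0,1:] * P) ^ q) z" by simp
    also have "\<dots> = of_int a ^ q + z ^ q * int_eval P z ^ q + of_nat q * int_eval C z"
      unfolding C by (simp add: power_mult_distrib)
    finally show ?thesis by (simp add: b' R algebra_simps)
  qed
  then show ?case by blast
qed

text \<open>Take an annihilating polynomial of least degree and make it primitive. Pseudo-division
  with Gauss's lemma shows that it divides every other one; as it divides \<open>X\<close>, which is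
  monic, its leading coefficient is a unit.\<close>

lemma int_min_poly:
  assumes "w ^ N = 1" "N > 0"
  obtains m where "degree m > 0" "is_unit (lead_coeff m)" "\<And>P. int_eval P w = 0 \<longleftrightarrow> m dvd P"
proof -
  define Z where "Z P \<longleftrightarrow> P \<noteq> 0 \<and> int_eval P w = 0" for P
  define X where "X = Polynomial.monom 1 N - (1 :: int poly)"
  have X: "int_eval X w = 0" using assms by (simp add: X_def)
  have degX: "degree X = N" and lcX: "lead_coeff X = 1"
  proof -
    show *: "degree X = N" unfolding X_def using assms(2)
      by (metis diff_conv_add_uminus degree_add_eq_left degree_minus degree_1 degree_monom_eq one_neq_zero)
    show "lead_coeff X = 1" unfolding * using assms(2) by (simp add: X_def)
  qed
  have "Z X" using X lcX by (auto simp: Z_def)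
  then obtain m0 where m0: "Z m0" and min: "\<And>P. Z P \<Longrightarrow> degree m0 \<le> degree P"
    using ex_has_least_nat[of Z X degree] by blast
  define m where "m = primitive_part m0"
  have m_nz: "m \<noteq> 0" and cm: "content m = 1" and dm: "degree m = degree m0"
    using m0 by (auto simp: m_def Z_def)
  have "int_eval m0 w = of_int (content m0) * int_eval m w"
    by (metis content_times_primitive_part int_eval_simps(8) m_def)
  then have mw: "int_eval m w = 0" using m0 by (auto simp: Z_def)
  have dvd: "m dvd P" if P: "int_eval P w = 0" for P
  proof -
    obtain a q where a: "a \<noteq> 0" and e: "Polynomial.smult a P = m * q + pseudo_mod P m"
      using pseudo_mod(1)[OF m_nz, of P] by blast
    have "int_eval (pseudo_mod P m) w = 0"
      using arg_cong[OF e, of "\<lambda>P. int_eval P w"] P mw by simp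
    then have "pseudo_mod P m = 0"
      using pseudo_mod(2)[OF m_nz, of P] min[of "pseudo_mod P m"] dm by (force simp: Z_def)
    with e have e: "Polynomial.smult a P = m * q" by simp
    \<comment> \<open>Gauss's lemma: \<open>m\<close> is primitive, so the factor \<open>a\<close>
      introduced by pseudo-division divides the content of \<open>q\<close> and can be
      cancelled.\<close>
    have "a dvd content (Polynomial.smult a P)" by simp
    also have "content (Polynomial.smult a P) = content q" unfolding e by (simp add: content_mult cm)
    finally obtain q' where "q = [:a:] * q'" by (auto simp: const_poly_dvd_iff_dvd_content[symmetric])
    then have "Polynomial.smult a P = Polynomial.smult a (m * q')" using e by simp
    then have "Polynomial.smult a (P - m * q') = 0" by (simp add: smult_diff_right)
    then have "P = m * q'" using a by simp
    then show ?thesis by simp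
  qed
  obtain k where k: "X = m * k" using dvd[OF X] by auto
  have "is_unit (lead_coeff m)" using lcX unfolding k by (metis lead_coeff_mult dvd_triv_left)
  moreover have "degree m > 0"
  proof (rule ccontr)
    assume "\<not> degree m > 0"
    then obtain c where c: "m = [:c:]" by (auto elim: degree_eq_zeroE)
    then show False using mw m_nz by simp
  qed
  moreover have "int_eval P w = 0 \<longleftrightarrow> m dvd P" for P
    using dvd mw by (auto elim!: dvdE)
  ultimately show ?thesis using that by blast
qed

text \<open>Divisibility of integers in Z[w] is divisibility in Z: after reducing \<open>R\<close>
  modulo the minimal polynomial, both sides have degree below it, so the equation holds between
  polynomials and constant coefficients can be compared.\<close>

lemma int_eval_integer_dvd:
  assumes "w ^ N = 1" "N > 0" and eq: "of_int c = of_int d * int_eval R w"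
  shows "d dvd c"
proof -
  obtain m where m: "degree m > 0" "is_unit (lead_coeff m)" "\<And>P. int_eval P w = 0 \<longleftrightarrow> m dvd P"
    using int_min_poly[OF assms(1,2)] by metis
  have m_nz: "m \<noteq> 0" using m by auto
  obtain q r where qr: "pseudo_divmod R m = (q, r)" by fastforce
  define a where "a = lead_coeff m ^ (Suc (degree R) - degree m)"
  have e: "Polynomial.smult a R = m * q + r" and r: "r = 0 \<or> degree r < degree m"
    using pseudo_divmod[OF m_nz qr] by (auto simp: a_def)
  have mw: "int_eval m w = 0" using m(3) by simp
  have "of_int a * int_eval R w = int_eval r w"
    using arg_cong[OF e, of "\<lambda>P. int_eval P w"] mw by simp
  then have "int_eval ([:a * c:] - Polynomial.smult d r) w = 0" using eq by (simp add: algebra_simps)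
  then have "m dvd [:a * c:] - Polynomial.smult d r" using m(3) by metis
  moreover have "degree ([:a * c:] - Polynomial.smult d r) < degree m"
    using r m(1) by (intro degree_diff_less) auto
  ultimately have "[:a * c:] = Polynomial.smult d r"
    by (metis (no_types, lifting) dvd_imp_degree_le eq_iff_diff_eq_0 not_le)
  then have "a * c = d * Polynomial.coeff r 0" by (metis coeff_pCons_0 coeff_smult)
  moreover have "is_unit a" using m(2) unfolding a_def by (metis dvd_power_same power_one)
  ultimately show ?thesis by (metis dvd_mult_unit_iff dvd_triv_left mult.commute)
qed

text \<open>Dedekind's argument for the irreducibility of cyclotomic polynomials. If
  \<open>w ^ q\<close> is a root of the cofactor \<open>k\<close> of \<open>m\<close>, Frobenius
  makes \<open>int_eval k w ^ q\<close> divisible by \<open>q\<close>. Differentiating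
  \<open>X = m * k\<close> at \<open>w\<close> then forces \<open>q\<close> to divide a power of
  \<open>N\<close>.\<close>

lemma int_eval_conjugate_prime:
  assumes w: "w ^ N = 1" "N > 0" and q: "prime q" "\<not> q dvd N" and P: "int_eval P w = 0"
  shows "int_eval P (w ^ q) = 0"
proof -
  obtain m where m: "\<And>P. int_eval P w = 0 \<longleftrightarrow> m dvd P"
    using int_min_poly[OF w] by metis
  define X where "X = Polynomial.monom 1 N - (1 :: int poly)"
  have "int_eval X w = 0" using w by (simp add: X_def)
  then obtain k where k: "X = m * k" using m by (auto elim: dvdE)
  obtain Q where Q: "P = m * Q" using m P by (auto elim: dvdE)
  have mw: "int_eval m w = 0" using m by simp
  have "int_eval m (w ^ q) = 0"
  proof (rule ccontr)
    assume "int_eval m (w ^ q) \<noteq> 0"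
    moreover have "int_eval X (w ^ q) = 0"
      using w by (simp add: X_def power_mult[symmetric] mult.commute[of q]) (simp add: power_mult)
    ultimately have kq: "int_eval k (w ^ q) = 0" unfolding k by simp
    obtain R where R: "\<And>z. int_eval k z ^ q = int_eval k (z ^ q) + of_nat q * int_eval R z"
      using int_eval_power_prime[OF q(1)] by blast
    have "pderiv X = pderiv m * k + m * pderiv k"
      unfolding k by (simp add: pderiv_mult mult.commute)
    moreover have "pderiv X = Polynomial.monom (int N) (N - 1)"
      by (simp add: X_def pderiv_diff pderiv_monom)
    ultimately have "of_nat N * w ^ (N - 1) = int_eval (pderiv m) w * int_eval k w"
      using mw by (metis (no_types, lifting) add.right_neutral int_eval_simps(1,3,10)
          mult_zero_left of_int_of_nat_eq)
    then have "(of_nat N * w ^ (N - 1) * w) ^ q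
        = of_nat q * int_eval (pderiv m ^ q * R * Polynomial.monom 1 q) w"
      using R[of w] kq by (simp add: power_mult_distrib)
    also have "of_nat N * w ^ (N - 1) * w = of_nat N"
      using w by (simp add: power_eq_if mult.commute)
    finally have "of_int (int (N ^ q)) = of_int (int q) * int_eval (pderiv m ^ q * R * Polynomial.monom 1 q) w"
      by simp
    then have "int q dvd int (N ^ q)" by (rule int_eval_integer_dvd[OF w])
    then show False using q prime_dvd_power int_dvd_int_iff by blast
  qed
  then show ?thesis unfolding Q by simp
qed

text \<open>Apply the prime case once for each prime factor of \<open>s\<close>; \<open>w\<close> is
  arbitrary in the induction because it is replaced by \<open>w ^ q\<close>, which need not have a
  prescribed order.\<close>

lemma int_eval_conjugate:
  assumes w: "w ^ N = 1" "N > 0" and s: "coprime s N" and P: "int_eval P w = 0"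
  shows "int_eval P (w ^ s) = 0"
  using assms
proof (induction s arbitrary: w rule: prime_divisors_induct)
  case zero
  then show ?case by simp
next
  case (unit s)
  then show ?case by simp
next
  case (factor q s)
  have "int_eval P (w ^ q) = 0"
    using factor by (intro int_eval_conjugate_prime) (auto simp: prime_imp_coprime coprime_commute)
  moreover have "(w ^ q) ^ N = 1" using factor by (metis mult.commute power_mult power_one)
  ultimately show ?case using factor by (simp add: power_mult)
qed

corollary int_eval_conjugate_eq:
  assumes "w ^ N = 1" "N > 0" "coprime s N" "int_eval P w = int_eval Q w"
  shows "int_eval P (w ^ s) = int_eval Q (w ^ s)"
  using int_eval_conjugate[OF assms(1-3), of "P - Q"] assms(4) by simp

section \<open>Divisibility in the ring generated by a root of unity\<close>

text \<open>This is the ring Z[w]; \<open>int_dvd w\<close> below is divisibility in it.\<close>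

definition int_ring :: "complex \<Rightarrow> complex set" where
  "int_ring w = range (\<lambda>P. int_eval P w)"

lemma int_eval_in_int_ring [simp, intro]: "int_eval P w \<in> int_ring w"
  by (auto simp: int_ring_def)

lemma int_ring_of_int [simp, intro]: "of_int c \<in> int_ring w"
  using int_eval_in_int_ring[of "[:c:]" w] by simp

lemma int_ring_of_nat [simp, intro]: "of_nat c \<in> int_ring w"
  using int_ring_of_int[of "int c"] by simp

lemma int_ring_1 [simp, intro]: "1 \<in> int_ring w"
  using int_ring_of_int[of 1] by simp

lemma int_ring_0 [simp, intro]: "0 \<in> int_ring w"
  using int_ring_of_int[of 0] by simp

lemma int_ring_self [simp, intro]: "w \<in> int_ring w"
  using int_eval_in_int_ring[of "[:0, 1:]" w] by simp

lemma int_ring_add [intro]: "x \<in> int_ring w \<Longrightarrow> y \<in> int_ring w \<Longrightarrow> x + y \<in> int_ring w"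
  unfolding int_ring_def by clarify (rule range_eqI, rule int_eval_simps(1)[symmetric])

lemma int_ring_diff [intro]: "x \<in> int_ring w \<Longrightarrow> y \<in> int_ring w \<Longrightarrow> x - y \<in> int_ring w"
  unfolding int_ring_def by clarify (rule range_eqI, rule int_eval_simps(2)[symmetric])

lemma int_ring_mult [intro]: "x \<in> int_ring w \<Longrightarrow> y \<in> int_ring w \<Longrightarrow> x * y \<in> int_ring w"
  unfolding int_ring_def by clarify (rule range_eqI, rule int_eval_simps(3)[symmetric])

lemma int_ring_uminus [intro]: "x \<in> int_ring w \<Longrightarrow> - x \<in> int_ring w"
  using int_ring_diff[of 0 w x] by simp

lemma int_ring_power [intro]: "x \<in> int_ring w \<Longrightarrow> x ^ k \<in> int_ring w"
  by (induction k) auto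

lemma int_ring_sum [intro]: "(\<And>i. i \<in> A \<Longrightarrow> f i \<in> int_ring w) \<Longrightarrow> sum f A \<in> int_ring w"
  by (induction A rule: infinite_finite_induct) auto

lemma int_eval_closed [intro]: "x \<in> int_ring w \<Longrightarrow> int_eval P x \<in> int_ring w"
  by (induction P) auto

definition int_dvd :: "complex \<Rightarrow> complex \<Rightarrow> complex \<Rightarrow> bool" where
  "int_dvd w x y \<longleftrightarrow> (\<exists>z\<in>int_ring w. y = x * z)"

lemma int_dvdI [intro]: "z \<in> int_ring w \<Longrightarrow> int_dvd w x (x * z)"
  by (auto simp: int_dvd_def)

lemma int_dvd_refl [simp, intro]: "int_dvd w x x"
  using int_dvdI[of 1 w x] by simp

lemma int_dvd_0 [simp, intro]: "int_dvd w x 0"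
  using int_dvdI[of 0 w x] by simp

lemma int_dvd_trans [trans]: "int_dvd w x y \<Longrightarrow> int_dvd w y z \<Longrightarrow> int_dvd w x z"
  unfolding int_dvd_def by clarify (rule bexI, rule mult.assoc, rule int_ring_mult)

lemma int_dvd_add: "int_dvd w x y \<Longrightarrow> int_dvd w x z \<Longrightarrow> int_dvd w x (y + z)"
  unfolding int_dvd_def by clarify (rule bexI, rule distrib_left[symmetric], rule int_ring_add)

lemma int_dvd_diff: "int_dvd w x y \<Longrightarrow> int_dvd w x z \<Longrightarrow> int_dvd w x (y - z)"
  unfolding int_dvd_def by clarify (rule bexI, rule right_diff_distrib[symmetric], rule int_ring_diff)

lemma int_dvd_mult_right: "int_dvd w x y \<Longrightarrow> z \<in> int_ring w \<Longrightarrow> int_dvd w x (y * z)"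
  unfolding int_dvd_def by clarify (rule bexI, rule mult.assoc, rule int_ring_mult)

lemma int_dvd_mult_left: "int_dvd w x y \<Longrightarrow> z \<in> int_ring w \<Longrightarrow> int_dvd w x (z * y)"
  by (metis int_dvd_mult_right mult.commute)

lemma int_dvd_mult_mono:
  assumes "int_dvd w x y" "int_dvd w x' y'"
  shows "int_dvd w (x * x') (y * y')"
proof -
  obtain z z' where "z \<in> int_ring w" "y = x * z" "z' \<in> int_ring w" "y' = x' * z'"
    using assms by (auto simp: int_dvd_def)
  then have "z * z' \<in> int_ring w" "y * y' = (x * x') * (z * z')" by auto
  then show ?thesis by (auto simp: int_dvd_def)
qed

lemma int_dvd_power_mono: "int_dvd w x y \<Longrightarrow> int_dvd w (x ^ k) (y ^ k)"
  by (induction k) (auto intro: int_dvd_mult_mono)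

lemma int_dvd_sum: "(\<And>i. i \<in> A \<Longrightarrow> int_dvd w x (f i)) \<Longrightarrow> int_dvd w x (sum f A)"
  by (induction A rule: infinite_finite_induct) (auto intro: int_dvd_add)

lemma int_dvd_power_diff:
  assumes "int_dvd w d (x - y)" "x \<in> int_ring w" "y \<in> int_ring w"
  shows "int_dvd w d (x ^ k - y ^ k)"
proof (cases k)
  case (Suc k')
  then show ?thesis unfolding Suc diff_power_eq_sum using assms
    by (intro int_dvd_mult_right) auto
qed simp

lemma int_dvd_int_eval_diff:
  assumes "int_dvd w d (x - y)" "x \<in> int_ring w" "y \<in> int_ring w"
  shows "int_dvd w d (int_eval P x - int_eval P y)"
proof (induction P)
  case (pCons a P)
  have "int_eval (pCons a P) x - int_eval (pCons a P) y
      = x * (int_eval P x - int_eval P y) + (x - y) * int_eval P y"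
    by (simp add: algebra_simps)
  also have "int_dvd w d \<dots>"
    using pCons assms by (intro int_dvd_add int_dvd_mult_left int_dvd_mult_right) auto
  finally show ?case .
qed simp

text \<open>Each \<open>p\<close>-th power gains one factor \<open>d\<close>: in
  \<open>X ^ p - Y ^ p = (X - Y) * S\<close> the sum \<open>S\<close> is congruent to
  \<open>p * Y ^ (p - 1)\<close>, hence to 0, modulo \<open>d\<close>.\<close>

lemma int_dvd_power_prime_power_diff:
  assumes p: "prime p" and pi: "int_dvd w d (of_nat p)"
    and xy: "int_dvd w d (x - y)" "x \<in> int_ring w" "y \<in> int_ring w"
  shows "int_dvd w (d ^ Suc k) (x ^ (p ^ k) - y ^ (p ^ k))"
proof (induction k)
  case (Suc k)
  define X Y where "X = x ^ (p ^ k)" and "Y = y ^ (p ^ k)"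
  have X: "X \<in> int_ring w" "Y \<in> int_ring w" using xy by (auto simp: X_def Y_def)
  have d: "int_dvd w d (X - Y)" unfolding X_def Y_def using xy by (rule int_dvd_power_diff)
  obtain p' where p': "p = Suc p'" using p not0_implies_Suc by (metis not_prime_0)
  have "int_dvd w d ((\<Sum>i<p. X ^ i * Y ^ (p' - i) - Y ^ p') + of_nat p * Y ^ p')"
  proof (intro int_dvd_add int_dvd_sum int_dvd_mult_right pi int_ring_power X)
    fix i assume "i \<in> {..<p}"
    then have "X ^ i * Y ^ (p' - i) - Y ^ p' = (X ^ i - Y ^ i) * Y ^ (p' - i)"
      using p' by (simp add: algebra_simps power_add[symmetric])
    then show "int_dvd w d (X ^ i * Y ^ (p' - i) - Y ^ p')"
      using int_dvd_power_diff[OF d X] X by (simp add: int_dvd_mult_right int_ring_power)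
  qed
  also have "(\<Sum>i<p. X ^ i * Y ^ (p' - i) - Y ^ p') + of_nat p * Y ^ p' = (\<Sum>i<p. X ^ i * Y ^ (p' - i))"
    by (simp add: sum_subtractf)
  finally have "int_dvd w (d ^ Suc k * d) ((X - Y) * (\<Sum>i<p. X ^ i * Y ^ (p' - i)))"
    using Suc by (intro int_dvd_mult_mono) (auto simp: X_def Y_def)
  also have "(X - Y) * (\<Sum>i<p. X ^ i * Y ^ (p' - i)) = X ^ p - Y ^ p"
    unfolding p' diff_power_eq_sum by simp
  finally show ?case by (simp add: X_def Y_def power_mult[symmetric] mult.commute)
qed (use xy in simp)

section \<open>Total ramification\<close>

text \<open>
  The primes above \<open>p\<close> are totally ramified over the \<open>h\<close>-th cyclotomic field and therefore fixed
  by every conjugation that fixes the \<open>h\<close>-th roots of unity. The following locale replaces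
  this by congruences modulo powers of \<open>1 - w ^ h\<close>.
\<close>

locale ramified =
  fixes w :: complex and p a h :: nat
  assumes p: "prime p" and a: "a > 0" and h: "h > 0" "\<not> p dvd h"
    and w: "w ^ (h * p ^ a) = 1" and prim: "w ^ (h * p ^ (a - 1)) \<noteq> 1"
begin

abbreviation \<zeta> where "\<zeta> \<equiv> w ^ h"

lemma N_pos: "h * p ^ a > 0"
  using h p prime_gt_0_nat by simp

lemma zeta_power: "\<zeta> ^ (p ^ a) = 1"
  using w by (simp add: power_mult)

lemma uniformizer_dvd_conjugate: "int_dvd w (1 - \<zeta>) (1 - \<zeta> ^ k)"
  unfolding one_diff_power_eq by (intro int_dvdI int_ring_sum int_ring_power int_ring_self)

text \<open>The conjugations \<open>w\<close> to \<open>w ^ (1 + h * k)\<close> fix the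
  \<open>h\<close>-th roots of unity; like inertia, they act trivially modulo
  \<open>1 - \<zeta>\<close>.\<close>

lemma uniformizer_dvd_conjugate_diff:
  "int_dvd w (1 - \<zeta>) (int_eval P (w ^ (1 + h * k)) - int_eval P w)"
proof (intro int_dvd_int_eval_diff int_ring_power int_ring_self)
  have "w ^ (1 + h * k) - w = (1 - \<zeta> ^ k) * (- w)"
    by (simp add: power_mult algebra_simps)
  then show "int_dvd w (1 - \<zeta>) (w ^ (1 + h * k) - w)"
    using int_dvd_mult_right[OF uniformizer_dvd_conjugate int_ring_uminus[OF int_ring_self]] by metis
qed

text \<open>With \<open>W\<close> of order \<open>p\<close>, the vanishing of the sum of its powers
  writes \<open>p\<close> as a sum of terms \<open>1 - W ^ i\<close>.\<close>

lemma uniformizer_dvd_p: "int_dvd w (1 - \<zeta>) (of_nat p)"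
proof -
  define W where "W = \<zeta> ^ (p ^ (a - 1))"
  have "W ^ p = \<zeta> ^ (p ^ a)"
    unfolding W_def power_mult[symmetric] using a by (simp only: mult.assoc power_minus_mult)
  then have "W ^ p = 1" using zeta_power by simp
  moreover have "W \<noteq> 1" using prim by (simp add: W_def power_mult)
  ultimately have "(\<Sum>i<p. W ^ i) = 0"
    using one_diff_power_eq[of W p] by simp
  then have "of_nat p = (\<Sum>i<p. 1 - W ^ i)" by (simp add: sum_subtractf)
  also have "int_dvd w (1 - \<zeta>) \<dots>"
    unfolding W_def by (intro int_dvd_sum) (metis power_mult uniformizer_dvd_conjugate)
  finally show ?thesis .
qed

lemma p_dvd_power_prime_power_diff:
  "int_dvd w (of_nat p) (int_eval P w ^ (p ^ r) - int_eval P (w ^ (p ^ r)))"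
proof (induction r)
  case (Suc r)
  obtain R where R: "\<And>z. int_eval P z ^ p = int_eval P (z ^ p) + of_nat p * int_eval R z"
    using int_eval_power_prime[OF p] by blast
  have in_ring: "int_eval Q (w ^ k) \<in> int_ring w" for Q k by auto
  have "int_dvd w (of_nat p) ((int_eval P w ^ (p ^ r)) ^ p - int_eval P (w ^ (p ^ r)) ^ p)"
    using Suc in_ring[of _ 1] by (intro int_dvd_power_diff int_ring_power in_ring) auto
  moreover have "int_dvd w (of_nat p) (of_nat p * int_eval R (w ^ (p ^ r)))"
    using in_ring by blast
  ultimately have "int_dvd w (of_nat p)
     ((int_eval P w ^ (p ^ r)) ^ p - int_eval P (w ^ (p ^ r)) ^ p + of_nat p * int_eval R (w ^ (p ^ r)))"
    by (rule int_dvd_add)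
  then show ?case by (simp add: R power_mult[symmetric] mult.commute)
qed simp

text \<open>For \<open>r = totient h\<close>, the \<open>r\<close>-fold Frobenius sends
  \<open>w\<close> to \<open>w ^ (1 + h * k)\<close>, which is trivial modulo
  \<open>1 - \<zeta>\<close>. Thus the residue ring behaves like a product of finite fields.\<close>

lemma uniformizer_dvd_frobenius:
  obtains r where "r > 0" "\<And>P. int_dvd w (1 - \<zeta>) (int_eval P w ^ (p ^ r) - int_eval P w)"
proof -
  define r where "r = totient h"
  have "coprime p h" using p h(2) by (simp add: prime_imp_coprime)
  then have "[p ^ r = 1] (mod h)" unfolding r_def by (rule euler_theorem)
  moreover have "p ^ r \<noteq> 0" using p by auto
  ultimately obtain k where k: "p ^ r = 1 + h * k"
    by (metis cong_to_1'_nat mult.commute)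
  have "int_dvd w (1 - \<zeta>) (int_eval P w ^ (p ^ r) - int_eval P w)" for P
    using int_dvd_add[OF int_dvd_trans[OF uniformizer_dvd_p p_dvd_power_prime_power_diff[of P r]]
        uniformizer_dvd_conjugate_diff[of P k]]
    by (simp add: k)
  moreover have "r > 0" using h by (simp add: r_def)
  ultimately show ?thesis using that by blast
qed

text \<open>The \<open>a\<close>-fold Frobenius sends \<open>1 - \<zeta>\<close> to
  \<open>1 - \<zeta> ^ (p ^ a) = 0\<close>, so \<open>p\<close> divides
  \<open>(1 - \<zeta>) ^ (p ^ a)\<close>.\<close>

lemma uniformizer_power_dvd_p_power: "int_dvd w (of_nat p ^ a) ((1 - \<zeta>) ^ (p ^ a * a))"
proof -
  define P where "P = (1 - Polynomial.monom 1 h :: int poly)"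
  have "(w ^ (p ^ a)) ^ h = 1" using w by (metis mult.commute power_mult)
  then have "int_eval P w = 1 - \<zeta>" "int_eval P (w ^ (p ^ a)) = 0"
    by (simp_all add: P_def)
  then have "int_dvd w (of_nat p) ((1 - \<zeta>) ^ (p ^ a))"
    using p_dvd_power_prime_power_diff[of P a] by simp
  then show ?thesis unfolding power_mult by (rule int_dvd_power_mono)
qed

text \<open>Without ideals, split \<open>y = y * c + y * (1 - c)\<close> for a near-idempotent
  \<open>c\<close> that is a multiple of \<open>y\<close>. The second part is
  \<open>1 - \<zeta>\<close> times a ring element, to which the induction hypothesis for
  \<open>M\<close> applies; on the first part \<open>y' * c\<close> is visibly a multiple of
  \<open>y\<close>.\<close>

lemma conjugate_congruence:
  assumes s: "coprime (1 + h * k) (h * p ^ a)"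
  shows "\<exists>v\<in>int_ring w. int_dvd w ((1 - \<zeta>) ^ M) (int_eval Y (w ^ (1 + h * k)) - int_eval Y w * v)"
proof (induction M arbitrary: Y)
  case 0
  have "int_eval Y (w ^ (1 + h * k)) \<in> int_ring w" by auto
  then show ?case using int_dvdI[of _ w 1] by (intro bexI[of _ 0]) auto
next
  case (Suc M)
  define s where "s = 1 + h * k"
  define \<pi> where "\<pi> = 1 - \<zeta>"
  obtain r where r: "r > 0" "\<And>P. int_dvd w \<pi> (int_eval P w ^ (p ^ r) - int_eval P w)"
    using uniformizer_dvd_frobenius unfolding \<pi>_def by blast
  obtain q where q: "p ^ r = Suc (Suc q)"
    using less_imp_Suc_add[OF one_less_power[OF prime_gt_1_nat[OF p] r(1)]] by auto
  text \<open>
    Modulo \<open>1 - \<zeta>\<close>, the element \<open>c\<close> is the idempotent supported where \<open>y\<close> is a unit. Its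
    high power is fixed by the conjugation to high precision.
  \<close>
  define C1 C where "C1 = Y ^ Suc q" and "C = C1 ^ (p ^ M)"
  define y y' where "y = int_eval Y w" and "y' = int_eval Y (w ^ s)"
  define c c' where "c = int_eval C w" and "c' = int_eval C (w ^ s)"
  have ring: "y \<in> int_ring w" "y' \<in> int_ring w" "c \<in> int_ring w" "c' \<in> int_ring w"
    by (auto simp: y_def y'_def c_def c'_def)
  have "int_dvd w \<pi> (y * (y ^ Suc q) ^ e - y)" for e
  proof (induction e)
    case (Suc e)
    have "y * (y ^ Suc q) ^ Suc e - y = (y ^ (p ^ r) - y) * (y ^ Suc q) ^ e + (y * (y ^ Suc q) ^ e - y)"
      by (simp add: q algebra_simps)
    moreover have "int_dvd w \<pi> ((y ^ (p ^ r) - y) * (y ^ Suc q) ^ e)"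
      using r(2)[of Y] ring unfolding y_def by (intro int_dvd_mult_right int_ring_power)
    ultimately show ?case using int_dvd_add Suc by metis
  qed simp
  then have "int_dvd w \<pi> (y * c - y)" by (simp add: c_def C_def C1_def y_def)
  from int_dvd_diff[OF int_dvd_0 this] have "int_dvd w \<pi> (y * (1 - c))"
    by (simp add: algebra_simps)
  then obtain Y1 where Y1: "y * (1 - c) = \<pi> * int_eval Y1 w"
    unfolding int_dvd_def int_ring_def by blast
  define y1 y1' where "y1 = int_eval Y1 w" and "y1' = int_eval Y1 (w ^ s)"
  have "int_eval (Y * (1 - C)) w = int_eval ((1 - Polynomial.monom 1 h) * Y1) w"
    using Y1 by (simp add: y_def c_def \<pi>_def)
  then have "int_eval (Y * (1 - C)) (w ^ s) = int_eval ((1 - Polynomial.monom 1 h) * Y1) (w ^ s)"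
    using int_eval_conjugate_eq[OF w N_pos assms] unfolding s_def by blast
  then have Y1': "y' * (1 - c') = (1 - \<zeta> ^ s) * y1'"
    by (simp add: y'_def c'_def y1'_def power_mult[symmetric] mult.commute)
  obtain v1 where v1: "v1 \<in> int_ring w" "int_dvd w (\<pi> ^ M) (y1' - y1 * v1)"
    using Suc[of Y1] unfolding \<pi>_def y1_def y1'_def s_def by blast
  obtain u where u: "u \<in> int_ring w" "1 - \<zeta> ^ s = \<pi> * u"
    using uniformizer_dvd_conjugate[of s] unfolding \<pi>_def int_dvd_def by blast
  have "int_dvd w (\<pi> * \<pi> ^ M) (\<pi> * u * (y1' - y1 * v1))"
    using v1 u by (intro int_dvd_mult_mono int_dvdI) auto
  moreover have "\<pi> * u * (y1' - y1 * v1) = y' * (1 - c') - y * (1 - c) * (u * v1)"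
    unfolding Y1 Y1' u(2) y1_def by (simp add: algebra_simps)
  ultimately have d1: "int_dvd w (\<pi> ^ Suc M) (y' * (1 - c') - y * (1 - c) * (u * v1))"
    by simp
  \<comment> \<open>Both are \<open>p ^ M\<close>-th powers of elements congruent modulo
    \<open>\<pi>\<close>; this is why \<open>C\<close> carries that exponent.\<close>
  have "int_dvd w (\<pi> ^ Suc M) (c' - c)"
    unfolding c'_def c_def C_def int_eval_simps \<pi>_def s_def
    by (intro int_dvd_power_prime_power_diff p uniformizer_dvd_p uniformizer_dvd_conjugate_diff) auto
  then have d2: "int_dvd w (\<pi> ^ Suc M) ((c' - c) * y')"
    using ring by (intro int_dvd_mult_right)
  obtain e where e: "p ^ M = Suc e" using p by (metis not0_implies_Suc not_prime_0 power_not_zero)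
  define d where "d = y ^ q * (y ^ Suc q) ^ e"
  have d: "d \<in> int_ring w" "c = y * d"
    using ring(1) by (auto simp: d_def c_def C_def C1_def e y_def[symmetric])
  \<comment> \<open>The two summands are the multipliers for \<open>y' * (1 - c')\<close> and for
    \<open>y' * c = y * (y' * d)\<close>; replacing \<open>c'\<close> by \<open>c\<close> costs only
    \<open>d2\<close>.\<close>
  define v where "v = (1 - c) * (u * v1) + y' * d"
  have "v \<in> int_ring w"
    unfolding v_def by (intro int_ring_add int_ring_mult int_ring_diff int_ring_1 ring u v1 d)
  moreover have "int_dvd w (\<pi> ^ Suc M) (y' - y * v)"
    using int_dvd_add[OF d1 d2] by (simp add: v_def d(2) algebra_simps)
  ultimately show ?case unfolding \<pi>_def s_def y_def y'_def by blast
qed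

text \<open>At precision \<open>M = p ^ a * a\<close> the modulus is itself divisible by
  \<open>p ^ a\<close>, hence by \<open>int_eval Y w\<close>, and the congruence turns into
  divisibility.\<close>

lemma conjugate_dvd:
  assumes s: "coprime (1 + h * k) (h * p ^ a)" and y: "int_dvd w (int_eval Y w) (of_nat p ^ a)"
  shows "int_dvd w (int_eval Y w) (int_eval Y (w ^ (1 + h * k)))"
proof -
  obtain v where v: "v \<in> int_ring w"
    "int_dvd w ((1 - \<zeta>) ^ (p ^ a * a)) (int_eval Y (w ^ (1 + h * k)) - int_eval Y w * v)"
    using conjugate_congruence[OF s] by blast
  have "int_dvd w (int_eval Y w) (int_eval Y (w ^ (1 + h * k)) - int_eval Y w * v)"
    using y uniformizer_power_dvd_p_power v(2) by (blast intro: int_dvd_trans)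
  from int_dvd_add[OF this int_dvdI[OF v(1)]] show ?thesis by simp
qed

end

section \<open>Roots of unity and Kronecker's theorem\<close>

definition unity_root :: "nat \<Rightarrow> complex" where
  "unity_root n = cis (2 * pi / real n)"

lemma unity_root_power_mult:
  assumes "m > 0" shows "unity_root (n * m) ^ m = unity_root n"
  using assms by (cases "n = 0") (simp_all add: unity_root_def DeMoivre)

lemma unity_root_power_eq_1_iff:
  assumes "n > 0" shows "unity_root n ^ k = 1 \<longleftrightarrow> n dvd k"
proof
  assume "unity_root n ^ k = 1"
  then have "cos (real k * (2 * pi / real n)) = 1"
    by (simp add: unity_root_def DeMoivre complex_eq_iff)
  then obtain x :: int where "real k * (2 * pi / real n) = of_int x * 2 * pi"
    by (auto simp: cos_one_2pi_int)
  then have "real k = of_int x * real n" using assms by (simp add: field_simps)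
  then have "int k = x * int n" by (metis of_int_eq_iff of_int_mult of_int_of_nat_eq)
  then show "n dvd k" by (metis dvd_triv_right int_dvd_int_iff)
next
  assume "n dvd k"
  then obtain j where "k = n * j" by auto
  then have "real k * (2 * pi / real n) = 2 * pi * real j" using assms by simp
  then show "unity_root n ^ k = 1"
    unfolding unity_root_def DeMoivre using cis_multiple_2pi[of "real j"] by (simp only: Ints_of_nat)
qed

lemma unity_root_power [simp]: "n > 0 \<Longrightarrow> unity_root n ^ n = 1"
  by (simp add: unity_root_power_eq_1_iff)

lemma unity_root_nonzero [simp]: "unity_root n \<noteq> 0"
  by (simp add: unity_root_def)

lemma norm_unity_root [simp]: "norm (unity_root n) = 1"
  by (simp add: unity_root_def)

lemma root_of_unity_obtain:
  assumes "z ^ n = 1" "n > 0"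
  obtains k where "z = unity_root n ^ k"
proof -
  have "z \<in> (\<lambda>k. cis (2 * pi * real k / real n)) ` {..<n}"
    using bij_betw_roots_unity[OF assms(2)] assms(1) by (auto simp: bij_betw_def)
  then show ?thesis using that
    by (auto simp: unity_root_def DeMoivre mult_ac)
qed

lemma unity_root_power_cong:
  assumes "[j = k] (mod n)"
  shows "unity_root n ^ j = unity_root n ^ k"
proof (cases "n = 0")
  case False
  have "unity_root n ^ j = unity_root n ^ (j mod n)" for j
  proof -
    have "unity_root n ^ j = unity_root n ^ (n * (j div n) + j mod n)" by simp
    then show ?thesis using False by (simp only: power_add power_mult unity_root_power[OF gr0I] power_one mult_1)
  qed
  then show ?thesis using assms by (metis cong_def)
qed (use assms in simp)

lemma sum_root_of_unity_powers:
  assumes "z ^ n = 1"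
  shows "(\<Sum>i<n. z ^ i) = (if z = 1 then of_nat n else (0 :: complex))"
  using assms one_diff_power_eq[of z n] by auto

lemma sum_unity_root:
  assumes "n > 0"
  shows "(\<Sum>u<n. unity_root n ^ (u * j)) = (if n dvd j then of_nat n else 0)"
proof -
  have "(unity_root n ^ j) ^ n = 1"
    using assms by (simp add: power_mult[symmetric] unity_root_power_eq_1_iff)
  from sum_root_of_unity_powers[OF this] show ?thesis
    using assms by (simp add: unity_root_power_eq_1_iff power_mult[symmetric] mult.commute)
qed

text \<open>Inclusion-exclusion over \<open>F\<close>; the induction needs all divisors \<open>e\<close> at once.\<close>

lemma sum_unity_root_sieve_int:
  assumes "N > 0" "finite F" "\<And>l. l \<in> F \<Longrightarrow> l dvd N" "e dvd N"
  shows "(\<Sum>s | s < N \<and> e dvd s \<and> (\<forall>l\<in>F. \<not> l dvd s). unity_root N ^ (s * j)) \<in> \<int>"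
  using assms(2-4)
proof (induction F arbitrary: e rule: finite_induct)
  case empty
  then obtain m where m: "N = e * m" by auto
  with assms(1) have pos: "e > 0" "m > 0" by auto
  have "{s. s < N \<and> e dvd s} = (\<lambda>i. e * i) ` {..<m}"
    using pos by (auto simp: m elim!: dvdE)
  moreover have "inj_on (\<lambda>i. e * i) {..<m}" using pos by (auto simp: inj_on_def)
  ultimately have "(\<Sum>s | s < N \<and> e dvd s. unity_root N ^ (s * j))
      = (\<Sum>i<m. (unity_root N ^ e) ^ (i * j))"
    by (simp add: sum.reindex power_mult[symmetric] mult.assoc)
  also have "unity_root N ^ e = unity_root m"
    unfolding m using unity_root_power_mult[OF pos(1), of m] by (simp add: mult.commute)
  also have "(\<Sum>i<m. unity_root m ^ (i * j)) \<in> \<int>" using pos by (simp add: sum_unity_root)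
  finally show ?case by simp
next
  case (insert l F)
  define A where "A e = {s. s < N \<and> e dvd s \<and> (\<forall>l\<in>F. \<not> l dvd s)}" for e
  have "{s. s < N \<and> e dvd s \<and> (\<forall>l\<in>insert l F. \<not> l dvd s)} = A e - A (lcm e l)"
    by (auto simp: A_def)
  moreover have "A (lcm e l) \<subseteq> A e" by (auto simp: A_def)
  moreover have "finite (A e)" by (simp add: A_def)
  ultimately have "(\<Sum>s | s < N \<and> e dvd s \<and> (\<forall>l\<in>insert l F. \<not> l dvd s). unity_root N ^ (s * j))
      = (\<Sum>s\<in>A e. unity_root N ^ (s * j)) - (\<Sum>s\<in>A (lcm e l). unity_root N ^ (s * j))"
    by (simp add: sum_diff)
  moreover have "(\<Sum>s\<in>A e. unity_root N ^ (s * j)) \<in> \<int>" if "e dvd N" for e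
    unfolding A_def using insert that by auto
  ultimately show ?case using insert by (simp add: lcm_least Ints_diff)
qed

text \<open>These are Ramanujan sums: coprimality to \<open>N\<close> means avoiding its prime
  factors, which is the sieve with \<open>e = 1\<close>.\<close>

lemma sum_coprime_unity_root_int:
  assumes "N > 0"
  shows "(\<Sum>s | s < N \<and> coprime s N. unity_root N ^ (s * j)) \<in> \<int>"
proof -
  have "coprime s N \<longleftrightarrow> (\<forall>l\<in>prime_factors N. \<not> l dvd s)" for s
  proof
    assume "coprime s N"
    then show "\<forall>l\<in>prime_factors N. \<not> l dvd s"
      by (metis coprime_common_divisor in_prime_factors_iff not_prime_unit)
  next
    assume *: "\<forall>l\<in>prime_factors N. \<not> l dvd s"
    show "coprime s N"
    proof (rule ccontr)
      assume "\<not> coprime s N"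
      then obtain l where "prime l" "l dvd gcd s N"
        by (metis coprime_iff_gcd_eq_1 prime_factor_nat)
      then show False using * assms by (auto simp: in_prime_factors_iff)
    qed
  qed
  then show ?thesis
    using sum_unity_root_sieve_int[of N "prime_factors N" 1 j] assms
    by (simp add: in_prime_factors_iff)
qed

text \<open>The sum is the trace of an element of the \<open>N\<close>-th cyclotomic ring.\<close>

lemma sum_int_eval_coprime_int:
  assumes "N > 0"
  shows "(\<Sum>s | s < N \<and> coprime s N. int_eval P (unity_root N ^ s)) \<in> \<int>"
proof -
  have *: "int_eval P z = (\<Sum>j\<le>degree P. of_int (Polynomial.coeff P j) * z ^ j)" for z
    unfolding int_eval_def poly_altdef by (simp add: of_int_hom.degree_map_poly_hom)
  have "(\<Sum>s | s < N \<and> coprime s N. int_eval P (unity_root N ^ s))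
      = (\<Sum>j\<le>degree P. of_int (Polynomial.coeff P j) * (\<Sum>s | s < N \<and> coprime s N. unity_root N ^ (s * j)))"
    unfolding * sum_distrib_left by (subst sum.swap) (simp add: power_mult)
  also have "\<dots> \<in> \<int>"
    using sum_coprime_unity_root_int[OF assms] by (blast intro: Ints_sum Ints_mult Ints_of_int)
  finally show ?thesis .
qed

text \<open>
  Kronecker's argument: the Fourier coefficients of the powers of \<open>V\<close> are rational integers of
  bounded size, so two powers agree.
\<close>

lemma conjugates_norm_1_imp_root_of_unity:
  assumes N: "N > 0"
    and V: "\<And>s. coprime s N \<Longrightarrow> norm (int_eval V (unity_root N ^ s)) = 1"
  shows "\<exists>k>0. int_eval V (unity_root N) ^ k = 1"
proof -
  define S where "S = {s. s < N \<and> coprime s N}"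
  define T where "T k g = (\<Sum>s\<in>S. int_eval V (unity_root N ^ s) ^ k * unity_root N ^ (s * g))" for k g
  define B where "B = (of_int ` {- int N..int N} :: complex set)"
  have finS: "finite S" "card S \<le> N"
  proof -
    have "S \<subseteq> {..<N}" by (auto simp: S_def)
    then show "finite S" "card S \<le> N"
      using finite_subset card_mono[of "{..<N}" S] by auto
  qed
  have T: "T k g \<in> B" for k g
  proof -
    have "T k g = (\<Sum>s\<in>S. int_eval (V ^ k * Polynomial.monom 1 g) (unity_root N ^ s))"
      by (simp add: T_def power_mult)
    also have "\<dots> \<in> \<int>" unfolding S_def by (rule sum_int_eval_coprime_int[OF N])
    finally have "T k g \<in> \<int>" .
    then obtain c where c: "T k g = of_int c" by (auto elim: Ints_cases)
    have "norm (T k g) \<le> (\<Sum>s\<in>S. norm (int_eval V (unity_root N ^ s) ^ k * unity_root N ^ (s * g)))"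
      unfolding T_def by (rule norm_sum)
    also have "\<dots> = card S" using V by (simp add: S_def norm_mult norm_power)
    finally have "\<bar>real_of_int c\<bar> \<le> N" using finS c by simp
    then have "\<bar>c\<bar> \<le> int N" by linarith
    then show ?thesis unfolding B_def c by (auto simp: abs_le_iff)
  qed
  have inversion: "of_nat N * int_eval V (unity_root N) ^ k = (\<Sum>g<N. T k g * unity_root N ^ ((N - 1) * g))" for k
  proof -
    \<comment> \<open>\<open>S\<close> consists of residues below \<open>N\<close>, so the exponent
      1 is represented by 0 when \<open>N = 1\<close>.\<close>
    define s1 where "s1 = 1 mod N"
    have s1: "s1 \<in> S" unfolding S_def s1_def using N by simp
    have dvd: "N dvd (s + (N - 1)) \<longleftrightarrow> s = s1" if "s \<in> S" for s
    proof -
      have "N dvd (s + (N - 1)) \<longleftrightarrow> [s + (N - 1) = 1 + (N - 1)] (mod N)"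
        using N by (simp add: cong_def mod_eq_0_iff_dvd)
      also have "\<dots> \<longleftrightarrow> [s = 1] (mod N)" by (rule cong_add_rcancel_nat)
      also have "\<dots> \<longleftrightarrow> s mod N = s1" by (simp add: cong_def s1_def)
      also have "s mod N = s" using that by (simp add: S_def)
      finally show ?thesis .
    qed
    have "(\<Sum>g<N. T k g * unity_root N ^ ((N - 1) * g))
        = (\<Sum>s\<in>S. int_eval V (unity_root N ^ s) ^ k * (\<Sum>g<N. unity_root N ^ (g * (s + (N - 1)))))"
      unfolding T_def sum_distrib_left sum_distrib_right
      by (subst sum.swap) (simp only: add_mult_distrib2 power_add mult_ac)
    also have "\<dots> = (\<Sum>s\<in>S. if s = s1 then int_eval V (unity_root N ^ s) ^ k * of_nat N else 0)"
      using N dvd by (intro sum.cong) (auto simp: sum_unity_root)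
    also have "\<dots> = of_nat N * int_eval V (unity_root N ^ s1) ^ k"
      using finS s1 by simp
    also have "unity_root N ^ s1 = unity_root N"
      using unity_root_power_cong[of s1 1 N] by (simp add: s1_def cong_def)
    finally show ?thesis by simp
  qed
  \<comment> \<open>Pigeonhole: infinitely many exponents \<open>k\<close>, but only finitely many
    coefficient vectors with entries in \<open>B\<close>.\<close>
  have "(\<lambda>k. restrict (T k) {..<N}) ` UNIV \<subseteq> {..<N} \<rightarrow>\<^sub>E B"
    using T by (intro image_subsetI) (simp add: restrict_PiE_iff)
  moreover have "finite ({..<N} \<rightarrow>\<^sub>E B)" by (intro finite_PiE) (auto simp: B_def)
  ultimately have "finite (range (\<lambda>k. restrict (T k) {..<N}))" by (rule finite_subset)
  then have "\<not> inj (\<lambda>k. restrict (T k) {..<N})" using finite_imageD infinite_UNIV_nat by blast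
  then obtain k l where kl: "k < l" and eq: "restrict (T k) {..<N} = restrict (T l) {..<N}"
    unfolding inj_def by (metis linorder_neqE_nat)
  have "T k g = T l g" if "g < N" for g using fun_cong[OF eq, of g] that by simp
  then have "of_nat N * int_eval V (unity_root N) ^ k = of_nat N * int_eval V (unity_root N) ^ l"
    unfolding inversion by (intro sum.cong) auto
  moreover have "int_eval V (unity_root N) ^ l = int_eval V (unity_root N) ^ k * int_eval V (unity_root N) ^ (l - k)"
    using kl by (simp add: power_add[symmetric])
  moreover have "int_eval V (unity_root N) \<noteq> 0" using V[of 1] by auto
  ultimately have "int_eval V (unity_root N) ^ (l - k) = 1" using N by simp
  then show ?thesis using kl by (intro exI[of _ "l - k"]) simp
qed

section \<open>Roots of unity inside a cyclotomic ring\<close>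

lemma int_eval_pcompose [simp]: "int_eval (pcompose P Q) z = int_eval P (int_eval Q z)"
  by (induction P) (simp_all add: pcompose_pCons)

text \<open>The \<open>p\<close>-part of the order of \<open>v\<close> is at most
  \<open>p ^ a\<close>: inside a larger cyclotomic ring, a conjugation that fixes
  \<open>unity_root (h * p ^ a)\<close> fixes \<open>v\<close>, but it also raises the root of unity
  \<open>v\<close> to the power \<open>s\<close>.\<close>

lemma root_of_unity_in_int_ring:
  assumes p: "prime p" and a: "a > 0" and h: "h > 0" "\<not> p dvd h"
    and v: "v \<in> int_ring (unity_root (h * p ^ a))" and k: "v ^ k = 1" "k > 0"
  obtains h' where "h' > 0" "h dvd h'" "\<not> p dvd h'" "v ^ (h' * p ^ a) = 1"
proof -
  obtain k' e where k': "\<not> p dvd k'" "k = k' * p ^ e"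
    using prime_power_canonical[OF p k(2)] by blast
  define c h' where "c = k' * p ^ e" and "h' = h * k'"
  define W where "W = unity_root (h * p ^ a * c)"
  have pos: "p > 0" "k' > 0" "c > 0" "h' > 0" "h * p ^ a * c > 0"
    using p k h prime_gt_0_nat by (auto simp: c_def h'_def k'(2))
  have h': "\<not> p dvd h'" using k' h p by (simp add: h'_def prime_dvd_mult_iff)
  have W: "W ^ (h * p ^ a * c) = 1" using pos by (simp add: W_def)
  have "v ^ (h * p ^ a * c) = (v ^ k) ^ (h * p ^ a)"
    unfolding power_mult[symmetric] k'(2) c_def by (simp add: mult_ac)
  then have "v ^ (h * p ^ a * c) = 1" using k by simp
  then obtain i where i: "v = W ^ i"
    using root_of_unity_obtain pos unfolding W_def by metis
  obtain V where V: "v = int_eval V (unity_root (h * p ^ a))"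
    using v by (auto simp: int_ring_def)
  have Wc: "W ^ c = unity_root (h * p ^ a)"
    unfolding W_def using pos by (simp add: unity_root_power_mult)
  \<comment> \<open>This \<open>s\<close> is 1 modulo \<open>h * p ^ a\<close> and coprime to the
    whole order; \<open>v ^ s = v\<close> is then exactly the claimed relation.\<close>
  define s where "s = Suc (h' * p ^ a)"
  have "coprime s (h' * p ^ a)" unfolding s_def by (rule coprime_Suc_left_nat)
  then have "coprime s h" "coprime s k'" "coprime s p"
    using a by (simp_all add: h'_def)
  then have s: "coprime s (h * p ^ a * c)" by (simp add: c_def)
  have "int_eval (Polynomial.monom 1 i) W = int_eval (pcompose V (Polynomial.monom 1 c)) W"
    using V Wc by (simp add: i[symmetric])
  from int_eval_conjugate_eq[OF W pos(5) s this]
  have "int_eval (Polynomial.monom 1 i) (W ^ s) = int_eval (pcompose V (Polynomial.monom 1 c)) (W ^ s)" .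
  moreover have "(W ^ s) ^ c = W ^ c"
  proof -
    have "(W ^ s) ^ c = W ^ c * (W ^ (h * p ^ a * c)) ^ k'"
      unfolding power_mult[symmetric] power_add[symmetric] s_def h'_def by (simp add: algebra_simps)
    then show ?thesis using W by simp
  qed
  ultimately have "(W ^ s) ^ i = v" using V Wc by simp
  then have "v ^ s = v" unfolding i by (simp add: power_mult[symmetric] mult.commute)
  then have "v * v ^ (h' * p ^ a) = v" by (simp add: s_def)
  moreover have "v \<noteq> 0" using k by (auto simp: power_0_left)
  ultimately have "v ^ (h' * p ^ a) = 1" by simp
  moreover have "h dvd h'" by (simp add: h'_def)
  ultimately show ?thesis using that pos(4) h' by blast
qed

text \<open>Bezout: \<open>n * x = h * y + 1\<close> separates \<open>v\<close> into
  \<open>v ^ (n * x)\<close> and the inverse of \<open>v ^ (h * y)\<close>.\<close>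

lemma root_of_unity_coprime_split:
  fixes v :: complex
  assumes v: "v ^ (h * n) = 1" and hn: "h > 0" "n > 0" "coprime h n"
  obtains \<eta> j where "\<eta> ^ h = 1" "v = \<eta> * unity_root n ^ j"
proof -
  obtain x y where xy: "n * x = h * y + 1"
    using bezout_nat[of n h] hn by (metis coprime_iff_gcd_eq_1 gcd.commute not_gr0)
  have v0: "v \<noteq> 0" using v hn by (auto simp: power_0_left)
  have "inverse (v ^ (h * y)) ^ n = inverse ((v ^ (h * n)) ^ y)"
    unfolding power_inverse power_mult[symmetric] by (simp add: mult_ac)
  then have "inverse (v ^ (h * y)) ^ n = 1" using v by simp
  then obtain j where j: "inverse (v ^ (h * y)) = unity_root n ^ j"
    using root_of_unity_obtain hn by metis
  have "v ^ (n * x) = v ^ (h * y) * v" unfolding xy by simp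
  then have "v = v ^ (n * x) * unity_root n ^ j" unfolding j[symmetric] using v0 by simp
  moreover have "(v ^ (n * x)) ^ h = (v ^ (h * n)) ^ x"
    unfolding power_mult[symmetric] by (simp add: mult_ac)
  then have "(v ^ (n * x)) ^ h = 1" using v by simp
  ultimately show ?thesis using that by blast
qed

lemma coprime_roots_of_unity_eq_1:
  fixes x :: complex
  assumes "x ^ m = 1" "x ^ k = 1" "coprime m k"
  shows "x = 1"
proof (cases "m = 0")
  case False
  obtain i j where "m * i = k * j + 1"
    using bezout_nat[of m k] assms False by (metis coprime_iff_gcd_eq_1)
  then have "x ^ (m * i) = x ^ (k * j) * x" by simp
  then show ?thesis using assms by (simp add: power_mult)
qed (use assms in simp)

text \<open>Apply the automorphism that fixes \<open>h\<close>-th roots of unity and raises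
  \<open>n\<close>-th roots to the power \<open>u\<close>; its exponent \<open>s\<close> comes from
  the Chinese remainder theorem.\<close>

lemma cyclotomic_relation_conjugate:
  assumes hn: "h > 0" "n > 0" "coprime h n" and u: "coprime u n"
    and c: "\<And>g. g \<in> A \<Longrightarrow> c g ^ h = 1" "\<And>g. g \<in> B \<Longrightarrow> d g ^ h = 1"
    and eq: "(\<Sum>g\<in>A. c g * unity_root n ^ e g) = (\<Sum>g\<in>B. d g * unity_root n ^ e' g)"
  shows "(\<Sum>g\<in>A. c g * unity_root n ^ (e g * u)) = (\<Sum>g\<in>B. d g * unity_root n ^ (e' g * u))"
proof -
  define W where "W = unity_root (h * n)"
  have Wn: "W ^ n = unity_root h" unfolding W_def using hn by (simp add: unity_root_power_mult)
  have Wh: "W ^ h = unity_root n" unfolding W_def using hn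
    by (metis mult.commute unity_root_power_mult)
  have "\<forall>g\<in>A. \<exists>i. c g = unity_root h ^ i" "\<forall>g\<in>B. \<exists>i. d g = unity_root h ^ i"
    using c hn root_of_unity_obtain by metis+
  then obtain i j where i: "\<And>g. g \<in> A \<Longrightarrow> c g = unity_root h ^ i g"
    and j: "\<And>g. g \<in> B \<Longrightarrow> d g = unity_root h ^ j g"
    by metis
  obtain s where s: "[s = 1] (mod h)" "[s = u] (mod n)"
    using binary_chinese_remainder_nat[OF hn(3)] by blast
  have "coprime s h" using cong_imp_coprime[OF cong_sym[OF s(1)]] by simp
  moreover have "coprime s n" using cong_imp_coprime[OF cong_sym[OF s(2)]] u by simp
  ultimately have sN: "coprime s (h * n)" by simp
  define P Q where "P = (\<Sum>g\<in>A. Polynomial.monom 1 (n * i g + h * e g) :: int poly)"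
    and "Q = (\<Sum>g\<in>B. Polynomial.monom 1 (n * j g + h * e' g) :: int poly)"
  have P: "int_eval P (W ^ r) = (\<Sum>g\<in>A. (unity_root h ^ r) ^ i g * (unity_root n ^ r) ^ e g)"
    and Q: "int_eval Q (W ^ r) = (\<Sum>g\<in>B. (unity_root h ^ r) ^ j g * (unity_root n ^ r) ^ e' g)" for r
    unfolding P_def Q_def Wn[symmetric] Wh[symmetric] int_eval_sum int_eval_simps
    by (simp_all add: power_mult[symmetric] power_add[symmetric] algebra_simps)
  have "int_eval P (W ^ 1) = int_eval Q (W ^ 1)"
    unfolding P Q using eq i j by simp
  then have "int_eval P (W ^ s) = int_eval Q (W ^ s)"
    unfolding power_one_right by (intro int_eval_conjugate_eq[OF _ _ sN]) (use hn in \<open>simp_all add: W_def\<close>)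
  moreover have "unity_root h ^ s = unity_root h" "unity_root n ^ s = unity_root n ^ u"
    using unity_root_power_cong[OF s(1)] unity_root_power_cong[OF s(2)] by simp_all
  ultimately show ?thesis
    unfolding P Q using i j by (simp add: power_mult[symmetric] mult.commute)
qed

section \<open>Sequences with flat spectrum\<close>

lemma root_of_unity_norm:
  fixes z :: complex
  assumes "z ^ h = 1" "h > 0"
  shows "norm z = 1"
  using assms by (metis norm_ge_zero norm_one norm_power power_eq_1_iff zero_less_iff_neq_zero)

lemma root_of_unity_power_pred:
  fixes z :: complex
  assumes "z ^ m = 1" "m > 0"
  shows "z ^ ((m - 1) * k) = cnj (z ^ k)"
proof -
  have "norm z = 1" by (rule root_of_unity_norm[OF assms])
  then have "z * cnj z = 1" by (simp add: complex_norm_square[symmetric])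
  moreover have "z * z ^ (m - 1) = 1" using assms by (simp add: power_Suc[symmetric] del: power_Suc)
  ultimately have "z ^ (m - 1) = cnj z" by (metis mult.commute mult.left_commute mult_1)
  then show ?thesis by (simp add: power_mult)
qed

text \<open>The discrete Fourier transform on the cyclic group of order \<open>n\<close>, with
  frequencies taken as arbitrary naturals.\<close>

definition spec :: "nat \<Rightarrow> (nat \<Rightarrow> complex) \<Rightarrow> nat \<Rightarrow> complex" where
  "spec n f u = (\<Sum>g<n. f g * unity_root n ^ (g * u))"

lemma spec_cong:
  assumes "[u = u'] (mod n)"
  shows "spec n f u = spec n f u'"
  unfolding spec_def using assms
  by (intro sum.cong arg_cong2[of _ _ _ _ "(*)"] refl unity_root_power_cong cong_scalar_left)

text \<open>What a counterexample provides: \<open>f\<close> is the first column of the matrix and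
  \<open>flat\<close> expresses the orthogonality of its rows in the transform.\<close>

locale flat_sequence =
  fixes p a h n :: nat and f :: "nat \<Rightarrow> complex"
  assumes p: "prime p" and a: "a > 0" and h: "h > 0" "\<not> p dvd h"
    and n: "n = p ^ a"
    and f: "\<And>g. g < n \<Longrightarrow> f g ^ h = 1"
    and flat: "\<And>u. norm (spec n f u) ^ 2 = n"
begin

lemma n_pos: "n > 0"
  using p prime_gt_0_nat by (simp add: n)

lemma spec_nonzero: "spec n f u \<noteq> 0"
  using flat[of u] n_pos by auto

text \<open>The value at 1 times its complex conjugate is \<open>n = p ^ a\<close>, so it divides
  its conjugate at \<open>t\<close>; flatness gives all conjugates of the quotient modulus 1, and
  Kronecker's theorem applies.\<close>

lemma spec_mult_eq_root_of_unity:
  assumes t: "coprime t p"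
  obtains h' v where "h' > 0" "h dvd h'" "\<not> p dvd h'" "v ^ (h' * n) = 1" "spec n f t = v * spec n f 1"
proof -
  define w where "w = unity_root (h * n)"
  have hn: "h * n > 0" using h n_pos by simp
  have cop: "coprime h n" using p h(2) unfolding n by (metis coprime_commute coprime_power_right_iff prime_imp_coprime)
  have wn: "w ^ n = unity_root h" unfolding w_def using n_pos by (simp add: unity_root_power_mult)
  have wh: "w ^ h = unity_root n" unfolding w_def using h by (metis mult.commute unity_root_power_mult)
  have w: "w ^ (h * n) = 1" using hn by (simp add: w_def)
  have "\<forall>g\<in>{..<n}. \<exists>i. f g = unity_root h ^ i" using f h root_of_unity_obtain by (metis lessThan_iff)
  then obtain c where c: "\<And>g. g < n \<Longrightarrow> f g = unity_root h ^ c g" by (metis lessThan_iff)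
  \<comment> \<open>\<open>Y\<close> represents the transform at frequency 1 and \<open>Z\<close>
    its complex conjugate; the factors \<open>h - 1\<close> and \<open>n - 1\<close> invert the
    roots of unity.\<close>
  define Y Z where "Y = (\<Sum>g<n. Polynomial.monom 1 (n * c g + h * g) :: int poly)"
    and "Z = (\<Sum>g<n. Polynomial.monom 1 (n * ((h - 1) * c g) + h * ((n - 1) * g)) :: int poly)"
  have Y: "int_eval Y (w ^ s) = (\<Sum>g<n. (unity_root h ^ s) ^ c g * (unity_root n ^ s) ^ g)" for s
    unfolding Y_def wn[symmetric] wh[symmetric] int_eval_sum int_eval_simps
    by (simp add: power_mult[symmetric] power_add[symmetric] algebra_simps)
  have Z: "int_eval Z (w ^ s) = cnj (int_eval Y (w ^ s))" for s
  proof -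
    have 1: "(unity_root h ^ s) ^ h = 1" "(unity_root n ^ s) ^ n = 1"
      using h n_pos by (metis mult.commute power_mult power_one unity_root_power)+
    have "int_eval Z (w ^ s) = (\<Sum>g<n. (unity_root h ^ s) ^ ((h - 1) * c g) * (unity_root n ^ s) ^ ((n - 1) * g))"
      unfolding Z_def wn[symmetric] wh[symmetric] int_eval_sum int_eval_simps
      by (simp add: power_mult[symmetric] power_add[symmetric] algebra_simps)
    also have "\<dots> = cnj (int_eval Y (w ^ s))"
      unfolding Y root_of_unity_power_pred[OF 1(1) h(1)] root_of_unity_power_pred[OF 1(2) n_pos]
        cnj_sum complex_cnj_mult ..
    finally show ?thesis .
  qed
  have Ys: "int_eval Y (w ^ s) = spec n f s" if "[s = 1] (mod h)" for s
  proof -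
    have "unity_root h ^ s = unity_root h" using unity_root_power_cong[OF that] by simp
    then show ?thesis unfolding Y spec_def using c by (simp add: power_mult[symmetric] mult.commute)
  qed
  have Y1: "int_eval Y w = spec n f 1" using Ys[of 1] by simp
  have "int_eval (Y * Z) w = int_eval (of_nat n) w"
  proof -
    have "int_eval (Y * Z) w = complex_of_real (norm (int_eval Y w) ^ 2)"
      using Z[of 1] complex_norm_square[of "int_eval Y w"] by simp
    also have "\<dots> = of_nat n" unfolding Y1 flat by simp
    finally show ?thesis by simp
  qed
  note YZ = int_eval_conjugate_eq[OF w hn _ this]
  have normY: "norm (int_eval Y (w ^ s)) ^ 2 = n" if "coprime s (h * n)" for s
  proof -
    have "complex_of_real (norm (int_eval Y (w ^ s)) ^ 2) = of_nat n"
      using YZ[OF that] Z[of s] complex_norm_square[of "int_eval Y (w ^ s)"] by simp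
    then show ?thesis by (metis of_real_eq_iff of_real_of_nat_eq)
  qed
  interpret R: ramified w p a h
  proof
    show "w ^ (h * p ^ a) = 1" using w by (simp add: n)
    have "\<not> p ^ a dvd p ^ (a - 1)" using p a
      by (simp add: dvd_power_iff_le[OF prime_ge_2_nat])
    then show "w ^ (h * p ^ (a - 1)) \<noteq> 1"
      unfolding power_mult wh using n_pos by (simp add: unity_root_power_eq_1_iff n)
  qed (use p a h in auto)
  have "int_dvd w (int_eval Y w) (of_nat p ^ a)"
    using int_dvdI[OF int_eval_in_int_ring[of Z w], of "int_eval Y w"] YZ[of 1] by (simp add: n)
  then have dvd: "coprime (1 + h * k) (h * p ^ a) \<Longrightarrow> int_dvd w (int_eval Y w) (int_eval Y (w ^ (1 + h * k)))" for k
    using R.conjugate_dvd by blast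
  obtain s0 where s0: "[s0 = 1] (mod h)" "[s0 = t] (mod n)"
    using binary_chinese_remainder_nat[OF cop] by blast
  \<comment> \<open>The added multiple makes \<open>s\<close> visibly nonzero, so that
    \<open>s = 1 + h * k\<close> with a natural \<open>k\<close>.\<close>
  define s where "s = s0 + h * n"
  have s: "[s = 1] (mod h)" "[s = t] (mod n)"
    using s0 by (simp_all add: s_def cong_def)
  have "s \<noteq> 0" using hn by (simp add: s_def)
  then obtain k where k: "s = 1 + h * k" using s(1)
    by (metis cong_to_1'_nat mult.commute)
  have "coprime t n" using t by (simp add: n)
  have "coprime s h" using cong_imp_coprime[OF cong_sym[OF s(1)]] by simp
  moreover have "coprime s n" using cong_imp_coprime[OF cong_sym[OF s(2)]] \<open>coprime t n\<close> by simp
  ultimately have sN: "coprime s (h * n)" by simp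
  then have "int_dvd w (int_eval Y w) (int_eval Y (w ^ s))" using dvd unfolding k n by blast
  then obtain V where V: "int_eval Y (w ^ s) = int_eval Y w * int_eval V w"
    by (auto simp: int_dvd_def int_ring_def)
  have "norm (int_eval V (w ^ r)) = 1" if r: "coprime r (h * n)" for r
  proof -
    \<comment> \<open>The quotient relation is an equation between integer polynomials at
      \<open>w\<close>, so it can be conjugated by any admissible \<open>r\<close>.\<close>
    have "int_eval (pcompose Y (Polynomial.monom 1 s)) w = int_eval (Y * V) w" using V by simp
    from int_eval_conjugate_eq[OF w hn r this]
    have "int_eval Y (w ^ (r * s)) = int_eval Y (w ^ r) * int_eval V (w ^ r)" by (simp add: power_mult)
    then have "norm (int_eval Y (w ^ (r * s))) ^ 2 = norm (int_eval Y (w ^ r)) ^ 2 * norm (int_eval V (w ^ r)) ^ 2"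
      by (simp add: norm_mult power_mult_distrib)
    moreover have "coprime (r * s) (h * n)" using r sN by simp
    ultimately have "norm (int_eval V (w ^ r)) ^ 2 = 1" using normY r n_pos by simp
    then have "norm (int_eval V (w ^ r)) = 1 \<or> norm (int_eval V (w ^ r)) = - 1"
      by (simp only: power2_eq_1_iff)
    then show ?thesis using norm_ge_zero[of "int_eval V (w ^ r)"] by linarith
  qed
  then obtain m where m: "m > 0" "int_eval V w ^ m = 1"
    using conjugates_norm_1_imp_root_of_unity[OF hn, of V] unfolding w_def by blast
  have "int_eval V w \<in> int_ring (unity_root (h * p ^ a))" by (simp add: w_def n)
  then obtain h' where "h' > 0" "h dvd h'" "\<not> p dvd h'" "int_eval V w ^ (h' * p ^ a) = 1"
    using root_of_unity_in_int_ring[OF p a h _ m(2,1)] by blast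
  moreover have "spec n f t = int_eval V w * spec n f 1"
    using V Y1 Ys[OF s(1)] spec_cong[OF s(2)] by (simp add: mult.commute)
  ultimately show ?thesis using that by (simp add: n)
qed

text \<open>Split the factor at \<open>u = 1\<close> into parts of order prime to \<open>p\<close>
  and of \<open>p\<close>-power order, then conjugate. Since \<open>h\<close> divides
  \<open>h'\<close>, both \<open>f\<close> and \<open>\<eta>\<close> are fixed and only the second
  part becomes a \<open>u\<close>-th power.\<close>

lemma spec_multiplier:
  assumes t: "coprime t p"
  obtains h' \<eta> j where "h' > 0" "\<not> p dvd h'" "\<eta> ^ h' = 1"
    "\<And>u. coprime u p \<Longrightarrow> spec n f (t * u) = \<eta> * unity_root n ^ (j * u) * spec n f u"
proof -
  obtain h' v where h': "h' > 0" "h dvd h'" "\<not> p dvd h'"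
    and v: "v ^ (h' * n) = 1" "spec n f t = v * spec n f 1"
    using spec_mult_eq_root_of_unity[OF t] by metis
  have cop: "coprime h' n" using p h'(3) unfolding n by (metis coprime_commute coprime_power_right_iff prime_imp_coprime)
  obtain \<eta> j where \<eta>: "\<eta> ^ h' = 1" "v = \<eta> * unity_root n ^ j"
    using root_of_unity_coprime_split[OF v(1) h'(1) n_pos cop] by metis
  have f': "f g ^ h' = 1" if "g \<in> {..<n}" for g
    using f that h'(2) by (auto elim!: dvdE simp: power_mult)
  then have \<eta>f: "(\<eta> * f g) ^ h' = 1" if "g \<in> {..<n}" for g
    using that \<eta> by (simp add: power_mult_distrib)
  have eq: "(\<Sum>g<n. f g * unity_root n ^ (g * t)) = (\<Sum>g<n. \<eta> * f g * unity_root n ^ (j + g))"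
    using v(2) unfolding spec_def \<eta>(2) sum_distrib_left by (simp add: power_add mult_ac)
  have "spec n f (t * u) = \<eta> * unity_root n ^ (j * u) * spec n f u" if u: "coprime u p" for u
  proof -
    have "coprime u n" using u by (simp add: n)
    from cyclotomic_relation_conjugate[OF h'(1) n_pos cop this f' \<eta>f eq]
    show ?thesis
      unfolding spec_def sum_distrib_left by (simp add: power_add add_mult_distrib add_mult_distrib2 mult_ac)
  qed
  then show ?thesis using that h' \<eta> by blast
qed

end

section \<open>Fourier analysis on the cyclic group: shift, inversion, Parseval\<close>

lemma bij_betw_add_mod:
  assumes "n > 0"
  shows "bij_betw (\<lambda>g. (g + d) mod n) {..<n} {..<n :: nat}"
proof -
  have "inj_on (\<lambda>g. (g + d) mod n) {..<n}"
  proof (rule inj_onI)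
    fix x y assume xy: "x \<in> {..<n}" "y \<in> {..<n}" "(x + d) mod n = (y + d) mod n"
    then have "[x = y] (mod n)" by (metis cong_add_rcancel_nat cong_def)
    then show "x = y" using xy by (simp add: cong_def)
  qed
  moreover have "(\<lambda>g. (g + d) mod n) ` {..<n} \<subseteq> {..<n}" using assms by auto
  ultimately show ?thesis by (simp add: bij_betw_def endo_inj_surj)
qed

lemma spec_shift:
  assumes "n > 0"
  shows "spec n f u = unity_root n ^ (d * u) * spec n (\<lambda>g. f ((g + d) mod n)) u"
proof -
  have *: "unity_root n ^ ((g + d) mod n * u) = unity_root n ^ (d * u) * unity_root n ^ (g * u)" for g
  proof -
    have "[(g + d) mod n * u = d * u + g * u] (mod n)"
      by (simp add: cong_def mod_mult_left_eq add_mult_distrib add.commute)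
    then show ?thesis unfolding power_add[symmetric] by (rule unity_root_power_cong)
  qed
  have "spec n f u = (\<Sum>g<n. f ((g + d) mod n) * unity_root n ^ ((g + d) mod n * u))"
    unfolding spec_def by (rule sum.reindex_bij_betw[OF bij_betw_add_mod[OF assms], symmetric])
  then show ?thesis unfolding * by (simp add: spec_def sum_distrib_left mult_ac)
qed

lemma cnj_unity_root_power:
  "n > 0 \<Longrightarrow> cnj (unity_root n ^ k) = unity_root n ^ ((n - 1) * k)"
  by (rule root_of_unity_power_pred[symmetric]) simp_all

lemma spec_inversion:
  assumes b: "b < n"
  shows "(\<Sum>u<n. spec n F u * cnj (unity_root n ^ (b * u))) = of_nat n * F b"
proof -
  have n: "n > 0" using b by simp
  have dvd: "n dvd (g + (n - 1) * b) \<longleftrightarrow> g = b" if "g < n" for g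
  proof -
    have "n dvd (g + (n - 1) * b) \<longleftrightarrow> [g + (n - 1) * b = b + (n - 1) * b] (mod n)"
      using n by (simp add: cong_def mod_eq_0_iff_dvd add.commute[of b] diff_mult_distrib)
    also have "\<dots> \<longleftrightarrow> [g = b] (mod n)" by (rule cong_add_rcancel_nat)
    also have "\<dots> \<longleftrightarrow> g = b" using b that by (simp add: cong_def)
    finally show ?thesis .
  qed
  have "(\<Sum>u<n. spec n F u * cnj (unity_root n ^ (b * u)))
      = (\<Sum>g<n. F g * (\<Sum>u<n. unity_root n ^ (u * (g + (n - 1) * b))))"
    unfolding spec_def cnj_unity_root_power[OF n] sum_distrib_left sum_distrib_right
    by (subst sum.swap) (simp only: add_mult_distrib2 power_add mult_ac)
  also have "\<dots> = (\<Sum>g<n. if g = b then F g * of_nat n else 0)"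
    using n dvd by (intro sum.cong) (auto simp: sum_unity_root)
  finally show ?thesis using b by simp
qed

lemma spec_parseval:
  assumes "n > 0"
  shows "(\<Sum>u<n. norm (spec n F u) ^ 2) = n * (\<Sum>g<n. norm (F g) ^ 2)"
proof -
  have "of_real (\<Sum>u<n. norm (spec n F u) ^ 2) = (\<Sum>u<n. spec n F u * cnj (spec n F u))"
    by (simp only: of_real_sum complex_norm_square)
  also have "\<dots> = (\<Sum>u<n. \<Sum>g<n. cnj (F g) * (spec n F u * cnj (unity_root n ^ (g * u))))"
    by (subst (2) spec_def) (simp add: sum_distrib_left mult_ac)
  also have "\<dots> = (\<Sum>g<n. cnj (F g) * (of_nat n * F g))"
    by (subst sum.swap) (intro sum.cong refl, simp only: sum_distrib_left[symmetric] lessThan_iff spec_inversion)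
  also have "\<dots> = of_real (n * (\<Sum>g<n. norm (F g) ^ 2))"
    by (simp only: of_real_sum of_real_mult of_real_of_nat_eq sum_distrib_left complex_norm_square mult_ac)
  finally show ?thesis by (simp only: of_real_eq_iff)
qed

text \<open>Equality in the triangle inequality: every real part is at most 1, and together they
  reach the maximum.\<close>

lemma sum_unit_complex_eq_card:
  fixes x :: "'a \<Rightarrow> complex"
  assumes "finite A" "\<And>i. i \<in> A \<Longrightarrow> norm (x i) = 1" "sum x A = of_nat (card A)" "i \<in> A"
  shows "x i = 1"
proof -
  have "Re (sum x A) = card A" using assms(3) by simp
  then have "(\<Sum>i\<in>A. 1 - Re (x i)) = 0" by (simp add: sum_subtractf)
  moreover have "1 - Re (x i) \<ge> 0" if "i \<in> A" for i
    using complex_Re_le_cmod[of "x i"] assms(2)[OF that] by simp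
  ultimately have "1 - Re (x i) = 0"
    using sum_nonneg_eq_0_iff[OF assms(1), of "\<lambda>i. 1 - Re (x i)"] assms(4) by blast
  moreover have "Re (x i) ^ 2 + Im (x i) ^ 2 = 1"
    using assms(2)[OF assms(4)] cmod_power2[of "x i"] by simp
  ultimately show ?thesis by (simp add: complex_eq_iff)
qed

lemma cong_1_power_prime_power:
  fixes t p :: nat
  assumes "[t = 1] (mod p)"
  shows "[t ^ (p ^ k) = 1] (mod p ^ Suc k)"
proof -
  have "int p ^ Suc k dvd int t ^ (p ^ k) - 1"
  proof (induction k)
    case 0
    then show ?case using assms by (simp add: cong_int_iff[symmetric] cong_iff_dvd_diff)
  next
    case (Suc k)
    define x where "x = int t ^ (p ^ k)"
    have "[x ^ i = 1] (mod int p)" for i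
      using assms unfolding x_def power_mult[symmetric]
      by (metis cong_int_iff cong_pow of_nat_1 power_one)
    then have "[(\<Sum>i<p. x ^ i) = (\<Sum>i<p. 1)] (mod int p)" by (intro cong_sum) auto
    then have "int p dvd (\<Sum>i<p. x ^ i)" by (simp add: cong_def mod_eq_0_iff_dvd)
    then have "int p ^ Suc k * int p dvd (x - 1) * (\<Sum>i<p. x ^ i)"
      using Suc unfolding x_def by (intro mult_dvd_mono)
    also have "(x - 1) * (\<Sum>i<p. x ^ i) = x ^ p - 1" by (simp add: power_diff_1_eq)
    finally show ?case by (simp add: x_def power_mult[symmetric] mult.commute)
  qed
  then have "[int (t ^ (p ^ k)) = int 1] (mod int (p ^ Suc k))" by (simp add: cong_iff_dvd_diff)
  then show ?thesis by (simp only: cong_int_iff)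
qed

section \<open>Odd primes\<close>

context flat_sequence
begin

lemma flat_sequence_shift: "flat_sequence p a h n (\<lambda>g. f ((g + d) mod n))"
proof
  show "f ((g + d) mod n) ^ h = 1" for g using f n_pos by simp
  have "norm (spec n f u) = norm (spec n (\<lambda>g. f ((g + d) mod n)) u)" for u
    by (subst spec_shift[OF n_pos, of _ _ d]) (simp add: norm_mult norm_power)
  then show "norm (spec n (\<lambda>g. f ((g + d) mod n)) u) ^ 2 = n" for u using flat by simp
qed (use p a h n in auto)

lemma norm_entry:
  assumes "g < n"
  shows "norm (f g) = 1"
  using root_of_unity_norm f[OF assms] h by blast

text \<open>Computing the value at \<open>2 * t\<close> in both orders gives phases
  \<open>unity_root n ^ (j * 2)\<close> and \<open>unity_root n ^ j\<close>, so the phase is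
  trivial.\<close>

lemma odd_multipliers:
  assumes odd: "p \<noteq> 2" and two: "\<And>u. coprime u p \<Longrightarrow> spec n f (2 * u) = \<theta> * spec n f u"
    and t: "coprime t p"
  obtains h' \<eta> where "\<not> p dvd h'" "\<eta> ^ h' = 1" "\<And>u. coprime u p \<Longrightarrow> spec n f (t * u) = \<eta> * spec n f u"
proof -
  obtain h' \<eta> j where h': "h' > 0" "\<not> p dvd h'" "\<eta> ^ h' = 1"
    and \<eta>: "\<And>u. coprime u p \<Longrightarrow> spec n f (t * u) = \<eta> * unity_root n ^ (j * u) * spec n f u"
    using spec_multiplier[OF t] by metis
  have "coprime 2 p" using odd p primes_coprime two_is_prime_nat by metis
  have "spec n f (t * 2) = \<eta> * unity_root n ^ (j * 2) * (\<theta> * spec n f 1)"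
    using \<eta>[OF \<open>coprime 2 p\<close>] two[of 1] by simp
  moreover have "spec n f (2 * t) = \<theta> * (\<eta> * unity_root n ^ j * spec n f 1)"
    using two[OF t] \<eta>[of 1] by simp
  moreover have "\<theta> \<noteq> 0" using two[of 1] spec_nonzero by auto
  moreover have "\<eta> \<noteq> 0" using h' by (auto simp: power_0_left)
  ultimately have "unity_root n ^ (j * 2) = unity_root n ^ j"
    using spec_nonzero[of 1] by (simp add: mult.commute)
  then have "unity_root n ^ j = 1" by (simp add: power_mult power2_eq_square)
  then have "spec n f (t * u) = \<eta> * spec n f u" if "coprime u p" for u
    using \<eta>[OF that] by (simp add: power_mult)
  then show ?thesis using that h' by blast
qed

text \<open>Averaging over the frequencies \<open>(1 + p * i) * u\<close> annihilates every index
  not divisible by \<open>p ^ (a - 1)\<close>, leaving a transform of length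
  \<open>p\<close>.\<close>

lemma spec_reduce:
  assumes inv: "\<And>t u. [t = 1] (mod p) \<Longrightarrow> coprime u p \<Longrightarrow> spec n f (t * u) = spec n f u"
    and u: "coprime u p"
  shows "spec n f u = spec p (\<lambda>b. f (p ^ (a - 1) * b)) u"
proof -
  define m where "m = p ^ (a - 1)"
  have nm: "n = m * p" unfolding n m_def using power_minus_mult[OF a, of p] by simp
  have pos: "m > 0" "p > 0" using p prime_gt_0_nat by (auto simp: m_def)
  have cop: "coprime m u" using u by (simp add: m_def coprime_commute)
  have "spec n f ((1 + p * i) * u) = spec n f u" for i
    by (rule inv[OF _ u]) (simp only: cong_def mod_mult_self2)
  then have "of_nat m * spec n f u = (\<Sum>i<m. spec n f ((1 + p * i) * u))" by simp
  also have "\<dots> = (\<Sum>g<n. f g * unity_root n ^ (g * u) * (\<Sum>i<m. (unity_root n ^ p) ^ (i * (g * u))))"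
    unfolding spec_def sum_distrib_left
    by (subst sum.swap) (simp add: power_mult[symmetric] power_add[symmetric] algebra_simps)
  also have "unity_root n ^ p = unity_root m" unfolding nm using pos by (simp add: unity_root_power_mult)
  also have "(\<Sum>g<n. f g * unity_root n ^ (g * u) * (\<Sum>i<m. unity_root m ^ (i * (g * u))))
      = (\<Sum>g<n. if m dvd g then of_nat m * (f g * unity_root n ^ (g * u)) else 0)"
    using pos cop by (intro sum.cong refl) (simp add: sum_unity_root coprime_dvd_mult_left_iff)
  also have "\<dots> = (\<Sum>g\<in>{g. g < n \<and> m dvd g}. of_nat m * (f g * unity_root n ^ (g * u)))"
    by (simp add: sum.inter_filter[symmetric])
  also have "{g. g < n \<and> m dvd g} = (\<lambda>b. m * b) ` {..<p}"
    using pos by (auto simp: nm elim!: dvdE)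
  also have "(\<Sum>g\<in>(\<lambda>b. m * b) ` {..<p}. of_nat m * (f g * unity_root n ^ (g * u)))
      = (\<Sum>b<p. of_nat m * (f (m * b) * (unity_root n ^ m) ^ (b * u)))"
    using pos by (subst sum.reindex) (auto simp: inj_on_def power_mult[symmetric] mult.assoc)
  also have "unity_root n ^ m = unity_root p"
    unfolding nm using pos unity_root_power_mult[of m p] by (simp add: mult.commute)
  finally show ?thesis using pos by (simp add: spec_def m_def sum_distrib_left[symmetric])
qed

lemma odd_aux:
  assumes odd: "p \<noteq> 2" and two: "\<And>u. coprime u p \<Longrightarrow> spec n f (2 * u) = \<theta> * spec n f u"
  shows False
proof -
  have p2: "p > 2" using p odd prime_ge_2_nat[OF p] by simp
  have "spec n f (t * u) = spec n f u" if t: "[t = 1] (mod p)" and u: "coprime u p" for t u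
  proof -
    have "coprime t p" using cong_imp_coprime[OF cong_sym[OF t]] by simp
    from odd_multipliers[OF odd two this] obtain h' \<eta> where h': "\<not> p dvd h'" "\<eta> ^ h' = 1"
      and \<eta>: "\<And>u. coprime u p \<Longrightarrow> spec n f (t * u) = \<eta> * spec n f u" by metis
    have pow: "spec n f (t ^ k) = \<eta> ^ k * spec n f 1" for k
      by (induction k) (use \<eta> \<open>coprime t p\<close> in simp_all)
    \<comment> \<open>Iterating the multiplier \<open>n\<close> times returns to frequency 1, so
      \<open>\<eta>\<close> has order dividing a power of \<open>p\<close> as well as
      \<open>h'\<close>.\<close>
    have "[t ^ n = 1] (mod p ^ Suc a)" unfolding n by (rule cong_1_power_prime_power[OF t])
    then have "[t ^ n = 1] (mod n)" unfolding n by (rule cong_dvd_modulus_nat) simp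
    then have "\<eta> ^ n = 1" using pow[of n] spec_cong spec_nonzero[of 1] by (metis mult_cancel_right1)
    moreover have "coprime n h'" using p h'(1) unfolding n by (simp add: prime_imp_coprime)
    ultimately have "\<eta> = 1" using coprime_roots_of_unity_eq_1 h'(2) by blast
    then show ?thesis using \<eta>[OF u] by simp
  qed
  note reduce = spec_reduce[OF this]
  define F where "F b = f (p ^ (a - 1) * b)" for b
  define y where "y = spec p F"
  have y: "spec n f u = y u" if "coprime u p" for u
    using reduce[OF _ _ that] by (simp add: y_def F_def spec_def)
  have Fh: "F b ^ h = 1" and F1: "norm (F b) = 1" if "b < p" for b
  proof -
    have "p ^ (a - 1) * b < n" unfolding n using that a p prime_gt_0_nat
      by (metis mult_less_cancel1 power_minus_mult zero_less_power)
    then show "F b ^ h = 1" "norm (F b) = 1" using f norm_entry by (auto simp: F_def)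
  qed
  have p0: "p > 0" "1 < p" using p2 by auto
  have nz: "F 0 \<noteq> 0" using F1[OF p0(1)] by auto
  have split: "(\<Sum>u<p. z u) = z 0 + (\<Sum>u\<in>{1..<p}. z u)" for z :: "nat \<Rightarrow> complex"
    using p0 by (simp add: lessThan_atLeast0 sum.atLeast_Suc_lessThan)
  have cop: "coprime u p" if "u \<in> {1..<p}" for u
    using that p by (metis atLeastLessThan_iff coprime_commute nat_dvd_not_less not_one_le_zero prime_imp_coprime neq0_conv)
  have y1: "norm (y 1) ^ 2 = n" using y[of 1] flat[of 1] by simp
  show False
  proof (cases "\<forall>t. coprime t p \<longrightarrow> spec n f t = spec n f 1")
    case False
    then obtain t where t: "coprime t p" "spec n f t \<noteq> spec n f 1" by blast
    obtain \<eta> where \<eta>: "\<And>u. coprime u p \<Longrightarrow> spec n f (t * u) = \<eta> * spec n f u"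
      using odd_multipliers[OF odd two t(1)] by metis
    have "\<eta> \<noteq> 1" using t(2) \<eta>[of 1] by auto
    \<comment> \<open>Multiplication by \<open>t\<close> permutes the nonzero frequencies and scales
      \<open>y\<close> by \<open>\<eta>\<close>, hence \<open>S = \<eta> * S\<close> and
      \<open>S = 0\<close>. Only frequency 0 then contributes to \<open>F 0\<close>, which becomes
      the mean of the unimodular values \<open>F b\<close>.\<close>
    define S where "S = (\<Sum>u\<in>{1..<p}. y u)"
    have "bij_betw (\<lambda>u. (t * u) mod p) {1..<p} {1..<p}"
    proof -
      have "inj_on (\<lambda>u. (t * u) mod p) {1..<p}"
      proof (rule inj_onI)
        fix u v assume uv: "u \<in> {1..<p}" "v \<in> {1..<p}" "(t * u) mod p = (t * v) mod p"
        then have "[u = v] (mod p)" using t(1) by (metis cong_def cong_mult_lcancel_nat)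
        then show "u = v" using uv by (simp add: cong_def)
      qed
      moreover have "(\<lambda>u. (t * u) mod p) ` {1..<p} \<subseteq> {1..<p}"
      proof clarify
        fix u assume "u \<in> {1..<p}"
        then have "coprime (t * u) p" using cop t(1) by simp
        then have "\<not> p dvd t * u" using p0 by (metis coprime_common_divisor dvd_refl nat_dvd_1_iff_1 less_irrefl)
        then show "t * u mod p \<in> {1..<p}" using p0 by (simp add: mod_greater_zero_iff_not_dvd Suc_le_eq)
      qed
      ultimately show ?thesis by (simp add: bij_betw_def endo_inj_surj)
    qed
    then have "S = (\<Sum>u\<in>{1..<p}. y ((t * u) mod p))"
      unfolding S_def by (rule sum.reindex_bij_betw[symmetric])
    also have "\<dots> = (\<Sum>u\<in>{1..<p}. \<eta> * y u)"
    proof (rule sum.cong)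
      fix u assume u: "u \<in> {1..<p}"
      have "y ((t * u) mod p) = y (t * u)" unfolding y_def by (rule spec_cong) (simp add: cong_def)
      also have "\<dots> = \<eta> * y u" using \<eta>[OF cop[OF u]] y cop[OF u] t(1) by simp
      finally show "y ((t * u) mod p) = \<eta> * y u" .
    qed simp
    finally have "S = \<eta> * S" unfolding S_def sum_distrib_left .
    then have "S = 0" using \<open>\<eta> \<noteq> 1\<close> by simp
    moreover have "of_nat p * F 0 = (\<Sum>u<p. y u)"
      using spec_inversion[OF p0(1), of F] by (simp add: y_def)
    ultimately have "(\<Sum>b<p. F b) = of_nat p * F 0"
      unfolding split[of y] S_def by (simp add: y_def spec_def)
    then have "(\<Sum>b<p. F b / F 0) = of_nat (card {..<p})"
      unfolding sum_divide_distrib[symmetric] using nz by simp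
    moreover have "norm (F b / F 0) = 1" if "b < p" for b
      unfolding norm_divide F1[OF that] F1[OF p0(1)] by simp
    ultimately have quot: "F b / F 0 = 1" if "b < p" for b
      by (intro sum_unit_complex_eq_card[of "{..<p}" "\<lambda>b. F b / F 0"]) (simp_all only: lessThan_iff that finite_lessThan)
    have const: "F b = F 0" if "b < p" for b
      using quot[OF that] by (simp only: divide_eq_1_iff)
    have "y 1 = (\<Sum>b<p. F 0 * unity_root p ^ (b * 1))"
      unfolding y_def spec_def by (rule sum.cong, rule refl, subst const) simp_all
    also have "\<dots> = 0"
      using sum_unity_root[OF p0(1), of 1] p0 by (simp add: sum_distrib_left[symmetric])
    finally show False using y1 n_pos by simp
  next
    case True
    then have const: "y u = y 1" if "u \<in> {1..<p}" for u
    proof -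
      have "spec n f u = spec n f 1" using True cop[OF that] by blast
      then show ?thesis using y[OF cop[OF that]] y[OF coprime_1_left] by (simp only:)
    qed
    \<comment> \<open>Subtracting the inversion formulas at 0 and 1 removes frequency 0, the only
      one where \<open>y\<close> may differ from \<open>y 1\<close>.\<close>
    have "of_nat p * F 0 - of_nat p * F 1
        = (\<Sum>u<p. y u * (1 - cnj (unity_root p ^ (1 * u))))"
      using spec_inversion[OF p0(1), of F] spec_inversion[OF p0(2), of F]
      by (simp add: y_def right_diff_distrib sum_subtractf)
    also have "\<dots> = (\<Sum>u<p. y 1 * (1 - cnj (unity_root p ^ u)))"
    proof (intro sum.cong refl)
      fix u assume u: "u \<in> {..<p}"
      show "y u * (1 - cnj (unity_root p ^ (1 * u))) = y 1 * (1 - cnj (unity_root p ^ u))"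
      proof (cases "u = 0")
        case False
        then have "y u = y 1" using u by (intro const) auto
        then show ?thesis by simp
      qed simp
    qed
    also have "\<dots> = y 1 * (of_nat p - cnj (\<Sum>u<p. unity_root p ^ (u * 1)))"
      by (simp add: sum_distrib_left[symmetric] sum_subtractf)
    also have "(\<Sum>u<p. unity_root p ^ (u * 1)) = 0"
      unfolding sum_unity_root[OF p0(1)] using p0 by simp
    finally have "of_nat p * (F 0 - F 1) = of_nat p * y 1" by (simp add: algebra_simps)
    then have d: "F 0 - F 1 = y 1" using p0 by simp
    have "norm (y 1) \<le> 2" unfolding d[symmetric] using norm_triangle_ineq4[of "F 0" "F 1"] F1 p0 by simp
    then have "norm (y 1) ^ 2 \<le> 2 ^ 2" by (intro power_mono) auto
    then have "n \<le> 4" unfolding y1 by simp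
    moreover have "p dvd n" unfolding n using a by simp
    moreover have "n \<noteq> 4"
    proof
      assume "n = 4"
      then have "p dvd 2 ^ 2" using \<open>p dvd n\<close> by simp
      then show False using p odd by (metis prime_dvd_power primes_dvd_imp_eq two_is_prime_nat)
    qed
    moreover have "p \<le> n" using \<open>p dvd n\<close> n_pos by (rule dvd_imp_le)
    ultimately have n3: "n = 3" "p = 3" using p2 by auto
    \<comment> \<open>\<open>x\<close> has modulus 1 and distance \<open>sqrt 3\<close> from 1, so
      it is a primitive cube root of unity.\<close>
    define x where "x = F 1 / F 0"
    have x1: "norm x = 1" using F1 p0 by (simp add: x_def norm_divide)
    have "norm (1 - x) = norm (y 1)"
      unfolding d[symmetric] x_def using nz F1[OF p0(1)] norm_divide[of "F 0 - F 1" "F 0"]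
      by (simp add: diff_divide_distrib)
    then have "norm (1 - x) ^ 2 = 3" using y1 n3 by simp
    moreover have xx: "Re x ^ 2 + Im x ^ 2 = 1" using x1 cmod_power2[of x] by simp
    ultimately have re: "Re x = - 1 / 2"
      unfolding cmod_power2 by (simp add: power2_eq_square algebra_simps)
    then have im: "Im x ^ 2 = 3 / 4" using xx by (simp add: power2_eq_square)
    have "x ^ 3 = 1"
      using re im by (simp add: complex_eq_iff power3_eq_cube power2_eq_square algebra_simps)
    moreover have "x ^ h = 1" using Fh p0 by (simp add: x_def power_divide)
    moreover have "coprime 3 h" using h(2) p n3 prime_imp_coprime by metis
    ultimately have "x = 1" using coprime_roots_of_unity_eq_1 by blast
    then show False using re by simp
  qed
qed

lemma odd_False:
  assumes odd: "p \<noteq> 2"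
  shows False
proof -
  have "coprime 2 p" using odd p primes_coprime two_is_prime_nat by metis
  then obtain \<eta> j where \<eta>: "\<And>u. coprime u p \<Longrightarrow> spec n f (2 * u) = \<eta> * unity_root n ^ (j * u) * spec n f u"
    using spec_multiplier by metis
  \<comment> \<open>A shift by \<open>d\<close> changes the phase for the multiplier 2 by
    \<open>(2 - 1) * d\<close>, so \<open>d = j\<close> removes it.\<close>
  interpret shifted: flat_sequence p a h n "\<lambda>g. f ((g + j) mod n)" by (rule flat_sequence_shift)
  show False
  proof (rule shifted.odd_aux[OF odd])
    fix u assume u: "coprime u p"
    have "unity_root n ^ (j * u) * (unity_root n ^ (j * u) * spec n (\<lambda>g. f ((g + j) mod n)) (2 * u)) = spec n f (2 * u)"
      by (subst spec_shift[OF n_pos, of f _ j]) (simp add: mult.assoc[symmetric] power_add[symmetric] mult_2 distrib_left)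
    also have "\<dots> = \<eta> * unity_root n ^ (j * u) * (unity_root n ^ (j * u) * spec n (\<lambda>g. f ((g + j) mod n)) u)"
      unfolding \<eta>[OF u] by (subst spec_shift[OF n_pos, of f _ j]) simp
    finally show "spec n (\<lambda>g. f ((g + j) mod n)) (2 * u) = \<eta> * spec n (\<lambda>g. f ((g + j) mod n)) u"
      by simp
  qed
qed

end

section \<open>The prime 2\<close>

context flat_sequence
begin

lemma two_False:
  assumes p2: "p = 2" and a3: "a \<ge> 3"
  shows False
proof -
  define m :: nat where "m = 2 ^ (a - 3)"
  have m: "n = 8 * m" "m > 0"
    using power_add[of "2 :: nat" "a - 3" 3] a3 by (simp_all add: m_def n p2 mult.commute)
  have hodd: "odd h" using h(2) p2 by simp
  \<comment> \<open>Here \<open>t = 1 + n / 2\<close>, an involution modulo \<open>n\<close>;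
    applying its multiplier twice gives \<open>sq\<close>.\<close>
  define t where "t = 1 + 4 * m"
  have "coprime t p" by (simp add: t_def p2)
  from spec_multiplier[OF this] obtain h' \<eta> j where h': "h' > 0" "\<not> p dvd h'" "\<eta> ^ h' = 1"
    and \<eta>: "\<And>u. coprime u p \<Longrightarrow> spec n f (t * u) = \<eta> * unity_root n ^ (j * u) * spec n f u"
    by metis
  have "coprime n h'" using p h'(2) unfolding n by (simp add: prime_imp_coprime)
  have "t * t = 1 + n * (1 + 2 * m)" by (simp add: t_def m algebra_simps)
  then have "[t * t = 1] (mod n)" by (simp only: cong_def mod_mult_self2)
  then have "spec n f (t * t) = spec n f 1" by (rule spec_cong)
  moreover have "spec n f (t * t) = \<eta> * unity_root n ^ (j * t) * (\<eta> * unity_root n ^ j * spec n f 1)"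
    using \<eta>[OF \<open>coprime t p\<close>] \<eta>[of 1] by simp
  ultimately have sq: "\<eta> ^ 2 * unity_root n ^ (j * (1 + t)) = 1"
    using spec_nonzero[of 1] by (simp add: power2_eq_square power_add distrib_left mult_ac)
  have "(\<eta> ^ 2) ^ n = (\<eta> ^ 2 * unity_root n ^ (j * (1 + t))) ^ n"
    using n_pos by (simp add: power_mult_distrib power_mult[symmetric] unity_root_power_eq_1_iff)
  then have "(\<eta> ^ 2) ^ n = 1" unfolding sq by simp
  moreover have "(\<eta> ^ 2) ^ h' = 1" using h'(3) by (metis mult.commute power_mult power_one)
  ultimately have "\<eta> ^ 2 = 1" using coprime_roots_of_unity_eq_1 \<open>coprime n h'\<close> by blast
  moreover have "coprime 2 h'" using h'(2) p2 by simp
  ultimately have "\<eta> = 1" using coprime_roots_of_unity_eq_1 h'(3) by blast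
  define \<epsilon> where "\<epsilon> = unity_root n ^ j"
  \<comment> \<open>Because 8 divides \<open>n\<close>, \<open>1 + t\<close> is twice an odd number,
    and the odd factor is invertible on \<open>n\<close>-th roots of unity.\<close>
  have "1 + t = 2 * (1 + 2 * m)" by (simp add: t_def)
  then have "(\<epsilon> ^ 2) ^ (1 + 2 * m) = unity_root n ^ (j * (1 + t))"
    unfolding \<epsilon>_def by (simp only: power_mult[symmetric] mult.assoc)
  then have "(\<epsilon> ^ 2) ^ (1 + 2 * m) = 1" using sq \<open>\<eta> ^ 2 = 1\<close> by simp
  moreover have "(\<epsilon> ^ 2) ^ n = 1"
    unfolding \<epsilon>_def using n_pos by (simp add: power_mult[symmetric] unity_root_power_eq_1_iff)
  moreover have "coprime (1 + 2 * m) n" unfolding n p2 by simp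
  ultimately have "\<epsilon> ^ 2 = 1" using coprime_roots_of_unity_eq_1 by blast
  then have \<epsilon>: "\<epsilon> = 1 \<or> \<epsilon> = - 1" by (simp add: power2_eq_1_iff)
  have half: "unity_root n ^ (4 * m) = - 1"
  proof -
    have "unity_root n ^ (4 * m) = unity_root 2"
      unfolding m using unity_root_power_mult[of "4 * m" 2] m(2) by simp
    then show ?thesis by (simp add: unity_root_def)
  qed
  have tu: "spec n f (t * u) = \<epsilon> * spec n f u" if "odd u" for u
  proof -
    have "\<epsilon> ^ u = \<epsilon>" using \<epsilon> that by auto
    then show ?thesis using \<eta>[of u] that p2 \<open>\<eta> = 1\<close> by (simp add: \<epsilon>_def power_mult)
  qed
  \<comment> \<open>Since \<open>t\<close> multiplies the term at \<open>g\<close> by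
    \<open>(- 1) ^ g\<close> on odd frequencies, the relation \<open>tu\<close> keeps only this
    parity class.\<close>
  define F where "F g = (if (- 1) ^ g = \<epsilon> then f g else 0)" for g
  have F: "spec n F u = spec n f u" if u: "odd u" for u
  proof -
    have "unity_root n ^ (g * (t * u)) = (- 1) ^ g * unity_root n ^ (g * u)" for g
    proof -
      have "unity_root n ^ (g * (t * u)) = unity_root n ^ (g * u) * (unity_root n ^ (4 * m)) ^ (g * u)"
        unfolding power_mult[symmetric] power_add[symmetric] by (simp add: t_def algebra_simps)
      also have "(unity_root n ^ (4 * m)) ^ (g * u) = (- 1) ^ g"
        unfolding half using u by (simp add: uminus_power_if)
      finally show ?thesis by simp
    qed
    then have "spec n f (t * u) = (\<Sum>g<n. f g * ((- 1) ^ g * unity_root n ^ (g * u)))"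
      by (simp add: spec_def)
    then have "spec n f u + \<epsilon> * spec n f (t * u)
        = (\<Sum>g<n. f g * unity_root n ^ (g * u) * (1 + \<epsilon> * (- 1) ^ g))"
      unfolding spec_def[of n f u] sum_distrib_left sum.distrib[symmetric]
      by (simp only: distrib_left mult_1_left mult_1_right mult_ac sum_distrib_left sum.distrib)
    also have "\<dots> = (\<Sum>g<n. 2 * (F g * unity_root n ^ (g * u)))"
      using \<epsilon> by (intro sum.cong refl) (auto simp: F_def uminus_power_if)
    also have "\<dots> = 2 * spec n F u" by (simp add: spec_def sum_distrib_left)
    also have "spec n f u + \<epsilon> * spec n f (t * u) = 2 * spec n f u"
      using tu[OF u] \<open>\<epsilon> ^ 2 = 1\<close> by (simp add: power2_eq_square mult.assoc[symmetric])
    finally show ?thesis by simp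
  qed
  have parity: "(\<Sum>g<2 * k. if even g then 1 else 0) = real k" "(\<Sum>g<2 * k. if odd g then 1 else 0) = real k" for k
    by (induction k) auto
  have n2: "n = 2 * (4 * m)" using m by simp
  have "(\<Sum>g<n. norm (F g) ^ 2) = 4 * m"
  proof -
    have "(\<Sum>g<n. norm (F g) ^ 2) = (\<Sum>g<n. if (- 1) ^ g = \<epsilon> then 1 else 0)"
      by (intro sum.cong refl) (simp add: F_def norm_entry)
    also have "\<dots> = 4 * m"
    proof -
      have "(- 1 :: complex) ^ g = 1 \<longleftrightarrow> even g" "(- 1 :: complex) ^ g = - 1 \<longleftrightarrow> odd g" for g
        by (auto simp: uminus_power_if)
      then show ?thesis using \<epsilon> parity[of "4 * m"] unfolding n2 by fastforce
    qed
    finally show ?thesis .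
  qed
  then have total: "(\<Sum>u<n. norm (spec n F u) ^ 2) = n * (4 * m)"
    using spec_parseval[OF n_pos, of F] by simp
  \<comment> \<open>The \<open>4 * m\<close> odd frequencies, each contributing \<open>n\<close>,
    already exhaust the Parseval total.\<close>
  have "(\<Sum>u<n. (if odd u then 1 else 0) * real n) = n * (4 * m)"
    unfolding sum_distrib_right[symmetric] using parity(2)[of "4 * m"] n2 by simp
  then have "(\<Sum>u<n. norm (spec n F u) ^ 2 - (if odd u then 1 else 0) * real n) = 0"
    unfolding sum_subtractf total by simp
  moreover have "norm (spec n F u) ^ 2 - (if odd u then 1 else 0) * real n \<ge> 0" for u
    using F flat by simp
  ultimately have "norm (spec n F u) ^ 2 - (if odd u then 1 else 0) * real n = 0" if "u < n" for u
    using that sum_nonneg_eq_0_iff[of "{..<n}" "\<lambda>u. norm (spec n F u) ^ 2 - (if odd u then 1 else 0) * real n"]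
    by blast
  then have even0: "spec n F u = 0" if "u < n" "even u" for u
    using that by fastforce
  \<comment> \<open>An index in the surviving parity class; adding the even number
    \<open>4 * m = n / 2\<close> stays in it.\<close>
  define g where "g = (if \<epsilon> = 1 then 0 else 1 :: nat)"
  have g: "g < n" "g + 4 * m < n" using m by (auto simp: g_def)
  have "of_nat n * F (g + 4 * m) = (\<Sum>u<n. spec n F u * cnj (unity_root n ^ ((g + 4 * m) * u)))"
    using spec_inversion[OF g(2), of F] by simp
  also have "\<dots> = (\<Sum>u<n. - (spec n F u * cnj (unity_root n ^ (g * u))))"
  proof (intro sum.cong refl)
    fix u assume u: "u \<in> {..<n}"
    show "spec n F u * cnj (unity_root n ^ ((g + 4 * m) * u)) = - (spec n F u * cnj (unity_root n ^ (g * u)))"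
    proof (cases "even u")
      case True
      then show ?thesis using even0 u by simp
    next
      case False
      have "unity_root n ^ ((g + 4 * m) * u) = unity_root n ^ (g * u) * (unity_root n ^ (4 * m)) ^ u"
        by (simp add: add_mult_distrib power_add power_mult)
      then show ?thesis unfolding half using False by simp
    qed
  qed
  also have "\<dots> = - (of_nat n * F g)" using spec_inversion[OF g(1), of F] by (simp add: sum_negf)
  finally have "of_nat n * (F (g + 4 * m) + F g) = 0" by (simp add: distrib_left)
  then have "F (g + 4 * m) + F g = 0" using n_pos by (simp only: mult_eq_0_iff of_nat_eq_0_iff) simp
  then have "F (g + 4 * m) = - F g" by (simp only: eq_neg_iff_add_eq_0)
  moreover have "F g = f g" "F (g + 4 * m) = f (g + 4 * m)"
    using \<epsilon> by (auto simp: F_def g_def)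
  ultimately have "f (g + 4 * m) ^ h = - (f g ^ h)" using hodd by simp
  then show False using f g by simp
qed

end

section \<open>Cyclic Butson matrices\<close>

text \<open>Conjugating the relation and multiplying by \<open>a * b * c\<close> shows that the
  second and third elementary symmetric functions sum to 0, so
  \<open>(1 + a) * (1 + b) * (1 + c) = 1 + a + b + c = 0\<close>.\<close>

lemma unit_sum_4_opposite:
  fixes a b c :: complex
  assumes "norm a = 1" "norm b = 1" "norm c = 1" "1 + a + b + c = 0"
  shows "a = - 1 \<or> b = - 1 \<or> c = - 1"
proof -
  have 1: "a * cnj a = 1" "b * cnj b = 1" "c * cnj c = 1"
    using assms by (simp_all add: complex_norm_square[symmetric])
  have "cnj (1 + a + b + c) = 0" using assms(4) by simp
  then have "a * b * c * (1 + cnj a + cnj b + cnj c) = 0" by simp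
  also have "a * b * c * (1 + cnj a + cnj b + cnj c)
      = a * b * c + (a * cnj a) * (b * c) + (b * cnj b) * (a * c) + (c * cnj c) * (a * b)"
    by (simp add: algebra_simps)
  finally have "a * b * c + b * c + a * c + a * b = 0" unfolding 1 by simp
  then have "(1 + a) * (1 + b) * (1 + c) = 1 + a + b + c" by (simp add: algebra_simps)
  then have "1 + a = 0 \<or> 1 + b = 0 \<or> 1 + c = 0" using assms(4) by simp
  then show ?thesis by (metis add_eq_0_iff)
qed

lemma BH_row_inner_product:
  assumes "BH_cyclic n h H" "g < n" "g' < n"
  shows "(\<Sum>k<n. H $$ (g, k) * cnj (H $$ (g', k))) = (if g = g' then of_nat n else 0)"
proof -
  have H: "H \<in> carrier_mat n n" "H * mat_adjoint H = of_nat n \<cdot>\<^sub>m 1\<^sub>m n"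
    using assms(1) by (auto simp: BH_cyclic_def)
  have dim: "dim_row H = n" "dim_col H = n" using H(1) by auto
  have "(H * mat_adjoint H) $$ (g, g') = (\<Sum>k<n. H $$ (g, k) * cnj (H $$ (g', k)))"
    using assms(2,3) dim
    by (simp add: mat_adjoint_def mat_of_rows_def scalar_prod_def lessThan_atLeast0 conjugate_complex_def)
  moreover have "(of_nat n \<cdot>\<^sub>m 1\<^sub>m n) $$ (g, g') = (if g = g' then complex_of_nat n else 0)"
    using assms(2,3) by simp
  ultimately show ?thesis unfolding H(2) by (rule trans[OF sym])
qed

lemma BH_cyclic_entry:
  assumes "BH_cyclic n h H" "g < n" "k < n"
  shows "H $$ (g, k) = H $$ ((g + (n - k)) mod n, 0)"
proof (cases "k = 0")
  \<comment> \<open>The shift by \<open>- k\<close> is written \<open>n - k\<close>, which is below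
    \<open>n\<close> as invariance requires only when \<open>k\<close> is nonzero.\<close>
  case False
  then have "H $$ ((g + (n - k)) mod n, (k + (n - k)) mod n) = H $$ (g, k)"
    using assms unfolding BH_cyclic_def cyclic_invariant_def by (metis diff_less neq0_conv order_le_less_trans zero_le)
  then show ?thesis using assms(3) by simp
qed (use assms in simp)

text \<open>By invariance all columns have transforms of the same modulus. The sum of their squares
  is a Hermitian form in the character \<open>z\<close>, which orthogonality of the rows evaluates
  to \<open>n * n\<close>.\<close>

lemma BH_cyclic_flat:
  assumes BH: "BH_cyclic n h H" and n: "n > 0"
  shows "norm (spec n (\<lambda>g. H $$ (g, 0)) u) ^ 2 = n"
proof -
  define f where "f g = H $$ (g, 0)" for g
  define z where "z g = unity_root n ^ (g * u)" for g
  have z: "z g * cnj (z g) = 1" for g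
    unfolding complex_norm_square[symmetric] by (simp add: z_def norm_power)
  have col: "norm (\<Sum>g<n. H $$ (g, k) * z g) = norm (spec n f u)" if "k < n" for k
  proof -
    have "(\<Sum>g<n. H $$ (g, k) * z g) = spec n (\<lambda>g. f ((g + (n - k)) mod n)) u"
      unfolding spec_def z_def f_def using BH_cyclic_entry[OF BH _ that] by simp
    then show ?thesis
      by (subst spec_shift[OF n, of f _ "n - k"]) (simp add: norm_mult norm_power)
  qed
  have "complex_of_real (n * norm (spec n f u) ^ 2) = (\<Sum>k<n. complex_of_real (norm (\<Sum>g<n. H $$ (g, k) * z g) ^ 2))"
    using col by simp
  also have "\<dots> = (\<Sum>k<n. \<Sum>g<n. \<Sum>g'<n. z g * cnj (z g') * (H $$ (g, k) * cnj (H $$ (g', k))))"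
    unfolding complex_norm_square cnj_sum sum_product by (simp add: mult_ac)
  also have "\<dots> = (\<Sum>g<n. \<Sum>g'<n. z g * cnj (z g') * (\<Sum>k<n. H $$ (g, k) * cnj (H $$ (g', k))))"
    unfolding sum_distrib_left by (rule trans[OF sum.swap], rule sum.cong, rule refl, rule sum.swap)
  also have "\<dots> = (\<Sum>g<n. \<Sum>g'<n. if g = g' then z g * cnj (z g') * of_nat n else 0)"
    using BH_row_inner_product[OF BH] by (intro sum.cong refl) auto
  also have "\<dots> = of_real (n * n)" by (simp add: z)
  finally have "real n * norm (spec n f u) ^ 2 = real n * real n" by (metis of_real_eq_iff of_nat_mult)
  then show ?thesis using n unfolding f_def by simp
qed

theorem theorem3p5:
  fixes p a h :: nat
  assumes "prime p" and "a > 0" and "h > 0"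
    and "\<exists>H. BH_cyclic (p ^ a) h H"
  shows "p dvd h"
proof (rule ccontr)
  assume ndvd: "\<not> p dvd h"
  obtain H where BH: "BH_cyclic (p ^ a) h H" using assms(4) by blast
  have pos: "p ^ a > 0" using assms(1) prime_gt_0_nat by simp
  have Hh: "H $$ (g, k) ^ h = 1" if "g < p ^ a" "k < p ^ a" for g k
    using BH that by (auto simp: BH_cyclic_def)
  interpret flat: flat_sequence p a h "p ^ a" "\<lambda>g. H $$ (g, 0)"
    using assms ndvd Hh pos BH_cyclic_flat[OF BH pos] by unfold_locales auto
  have p2: "p = 2" using flat.odd_False by blast
  then have "odd h" using ndvd by simp
  have a: "a = 1 \<or> a = 2" using flat.two_False[OF p2] assms(2) by fastforce
  then have "1 < p ^ a" using p2 by auto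
  \<comment> \<open>Only orders 2 and 4 remain. The terms of the inner product of rows 0 and 1 are
    \<open>h\<close>-th roots of unity with sum 0; two opposite ones are impossible since
    \<open>h\<close> is odd.\<close>
  define x where "x k = H $$ (0, k) * cnj (H $$ (1, k))" for k
  have x0: "(\<Sum>k<p ^ a. x k) = 0"
    unfolding x_def using BH_row_inner_product[OF BH pos \<open>1 < p ^ a\<close>] by simp
  have xh: "x k ^ h = 1" if "k < p ^ a" for k
    using Hh[OF pos that] Hh[OF \<open>1 < p ^ a\<close> that] unfolding x_def
    by (metis complex_cnj_one complex_cnj_power mult_1 power_mult_distrib)
  have opp: False if "k < p ^ a" "x k = - x 0" for k
    using xh[OF that(1)] xh[OF pos] \<open>odd h\<close> unfolding that(2) by simp
  show False using a
  proof
    assume "a = 1"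
    then have "x 1 = - x 0" using x0 by (simp add: p2 numeral_2_eq_2 add_eq_0_iff)
    then show False using opp \<open>1 < p ^ a\<close> by blast
  next
    assume "a = 2"
    then have 4: "p ^ a = 4" using p2 by simp
    have nx: "norm (x k) = 1" if "k < 4" for k
      using root_of_unity_norm[OF xh assms(3)] that 4 by simp
    then have nz: "x 0 \<noteq> 0" by fastforce
    have "x 0 + x 1 + x 2 + x 3 = 0" using x0 unfolding 4 by (simp add: eval_nat_numeral)
    then have "1 + x 1 / x 0 + x 2 / x 0 + x 3 / x 0 = 0" using nz by (simp add: field_simps)
    then have "x 1 / x 0 = - 1 \<or> x 2 / x 0 = - 1 \<or> x 3 / x 0 = - 1"
      by (intro unit_sum_4_opposite) (simp_all add: nx norm_divide)
    then have "x 1 = - x 0 \<or> x 2 = - x 0 \<or> x 3 = - x 0" using nz by (simp add: field_simps)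
    then show False using opp[of 1] opp[of 2] opp[of 3] 4 by auto
  qed
qed

end
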